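(* Let $r>0$ and $a>0$. Then the problem of $n_\varepsilon(a^{rs}U^{r,a}(\mathbb I^s,w),L_2(\mathbb I^s,w))$ (as a function of $\varepsilon\in(0,1]$ and $s\in\mathbb N$) is weakly tractable but polynomially intractable.
   Context: $\mathbb N=\{1,2,\dots\}$, $\mathbb N_0=\mathbb N\cup\{0\}$, $\mathbb I^s=[-1,1]^s$. Fix $\alpha,\beta>-1$ (independent of $s$) and let $a:=(\alpha+\beta+1)/2$, assumed positive. $L_2(\mathbb I^s,w)$ is the Hilbert space with inner product $(f,g)_w=\int_{\mathbb I^s}f(\mathbf x)g(\mathbf x)w(\mathbf x)\,d\mathbf x$, where $w(\mathbf x)=\prod_{j=1}^s(1-x_j)^\alpha(1+x_j)^\beta$. $\{P^{(\alpha,\beta)}_k\}_{k\ge0}$ are the orthonormal Jacobi polynomials on $[-1,1]$ for the weight $(1-x)^\alpha(1+x)^\beta$; $P^{(\alpha,\beta)}_{\mathbf k}(\mathbf x)=\prod_{j=1}^sP^{(\alpha,\beta)}_{k_j}(x_j)$ for $\mathbf k\in\mathbb N_0^s$, and $f_{\mathbf k}=(f,P^{(\alpha,\beta)}_{\mathbf k})_w$. With $\lambda_a(\mathbf k):=\prod_{j=1}^s(a+k_j)$, $K^{r,a}(\mathbb I^s,w)$ is the space of $f\in L_2(\mathbb I^s,w)$ with finite norm $\|f\|_{K^{r,a}(\mathbb I^s,w)}=\bigl(\sum_{\mathbf k\in\mathbb N_0^s}\lambda_a(\mathbf k)^{2r}|f_{\mathbf k}|^2\bigr)^{1/2}$,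 and $U^{r,a}(\mathbb I^s,w)$ is its (closed) unit ball, so $a^{rs}U^{r,a}(\mathbb I^s,w)$ is the ball of radius $a^{rs}$. For a normed space $X$ and $W\subset X$ centrally symmetric, $n_\varepsilon(W,X)$ is the smallest $n\in\mathbb N_0$ such that some linear subspace $L\subset X$ of dimension $\le n$ satisfies $\sup_{f\in W}\inf_{g\in L}\|f-g\|_X\le\varepsilon$. For a family of problems indexed by $s\in\mathbb N$ with $\varepsilon$-dimensions $n_\varepsilon$, $\varepsilon\in(0,1]$: weakly tractable means $\lim_{\varepsilon^{-1}+s\to\infty}\frac{\ln n_\varepsilon}{\varepsilon^{-1}+s}=0$ (with the convention $\ln 0:=0$); polynomially tractable means there are nonnegative $C,p,q$ with $n_\varepsilon\le C s^q\varepsilon^{-p}$ for all $\varepsilon\in(0,1]$, $s\in\mathbb N$; polynomially intractable means not polynomially tractable. *)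

theory Defs
  imports "HOL-Probability.Probability" "HOL-Library.Function_Algebras"
    "HOL-Computational_Algebra.Polynomial"
begin

section \<open>Real-valued functions as a real vector space\<close>

instantiation "fun" :: (type, real_vector) real_vector
begin

definition scaleR_fun :: "real \<Rightarrow> ('a \<Rightarrow> 'b) \<Rightarrow> 'a \<Rightarrow> 'b"
  where "scaleR_fun c f = (\<lambda>x. c *\<^sub>R f x)"

instance
  by standard (auto simp: scaleR_fun_def fun_eq_iff scaleR_add_right scaleR_add_left)

end


section \<open>The \<open>\<epsilon>\<close>-dimension and tractability\<close>

definition dim_at_most :: "nat \<Rightarrow> 'v::real_vector set \<Rightarrow> bool"
  where "dim_at_most n L \<longleftrightarrow> (\<exists>B. finite B \<and> independent B \<and> span B = L \<and> card B \<le> n)"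

text \<open>
  The normed space is given by its carrier \<open>X\<close> and its norm \<open>N\<close> inside an ambient vector space.
  \<open>N\<close> may be a seminorm: then the value is that of the quotient of \<open>X\<close> by the null space of \<open>N\<close>,
  since a subspace of the quotient has dimension at most \<open>n\<close> iff it is the image of a subspace of
  \<open>X\<close> of dimension at most \<open>n\<close>. The value is \<open>\<infinity>\<close> if no finite-dimensional subspace suffices.
\<close>

definition eps_dim :: "real \<Rightarrow> 'v::real_vector set \<Rightarrow> 'v set \<Rightarrow> ('v \<Rightarrow> real) \<Rightarrow> enat"
  where "eps_dim \<epsilon> W X N =
    Inf (enat ` {n. \<exists>L. subspace L \<and> L \<subseteq> X \<and> dim_at_most n L \<and>
                       (SUP f\<in>W. INF g\<in>L. ereal (N (f - g))) \<le> ereal \<epsilon>})"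

definition ln_dim :: "enat \<Rightarrow> ereal"
  where "ln_dim n = (case n of enat m \<Rightarrow> (if m = 0 then 0 else ereal (ln (real m))) | \<infinity> \<Rightarrow> \<infinity>)"

definition weakly_tractable :: "(real \<Rightarrow> nat \<Rightarrow> enat) \<Rightarrow> bool"
  where "weakly_tractable n \<longleftrightarrow>
    ((\<lambda>(\<epsilon>, s). ln_dim (n \<epsilon> s) / ereal (1 / \<epsilon> + real s)) \<longlongrightarrow> 0)
      (inf (filtercomap (\<lambda>(\<epsilon>, s). 1 / \<epsilon> + real s) at_top) (principal ({0<..1} \<times> {1..})))"

definition polynomially_tractable :: "(real \<Rightarrow> nat \<Rightarrow> enat) \<Rightarrow> bool"
  where "polynomially_tractable n \<longleftrightarrow>
    (\<exists>C p q :: real. 0 \<le> C \<and> 0 \<le> p \<and> 0 \<le> q \<and>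
      (\<forall>\<epsilon>\<in>{0<..1}. \<forall>s\<ge>1.
        ereal_of_enat (n \<epsilon> s) \<le> ereal (C * real s powr q * \<epsilon> powr (- p))))"

definition polynomially_intractable :: "(real \<Rightarrow> nat \<Rightarrow> enat) \<Rightarrow> bool"
  where "polynomially_intractable n \<longleftrightarrow> \<not> polynomially_tractable n"


section \<open>Jacobi polynomials\<close>

definition jacobi_weight :: "real \<Rightarrow> real \<Rightarrow> real \<Rightarrow> real"
  where "jacobi_weight \<alpha> \<beta> x = (1 - x) powr \<alpha> * (1 + x) powr \<beta>"

text \<open>
  Orthonormality and \<open>degree (P k) = k\<close> determine each \<open>P k\<close> up to its sign, which is fixed by
  the positive leading coefficient; this is the usual sign, as all zeros of \<open>P k\<close> lie in
  \<open>]-1, 1[\<close> and hence \<open>poly (P k) 1 > 0\<close>.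
\<close>

definition orthonormal_jacobi :: "real \<Rightarrow> real \<Rightarrow> (nat \<Rightarrow> real poly) \<Rightarrow> bool"
  where "orthonormal_jacobi \<alpha> \<beta> P \<longleftrightarrow>
    (\<forall>k. degree (P k) = k \<and> 0 < lead_coeff (P k)) \<and>
    (\<forall>j k. (LINT x : {-1..1} | lborel. poly (P j) x * poly (P k) x * jacobi_weight \<alpha> \<beta> x)
            = (if j = k then 1 else 0))"

definition jacobi :: "real \<Rightarrow> real \<Rightarrow> nat \<Rightarrow> real poly"
  where "jacobi \<alpha> \<beta> = (THE P. orthonormal_jacobi \<alpha> \<beta> P)"


section \<open>Weighted spaces on the cube\<close>

text \<open>
  Points of \<open>\<real>\<^sup>s\<close> and multi-indices are extensional functions on \<open>{..<s}\<close>, so coordinates are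
  numbered from 0. \<open>cube s\<close> is Lebesgue measure on \<open>[-1, 1]\<^sup>s\<close>.
\<close>

definition cube :: "nat \<Rightarrow> (nat \<Rightarrow> real) measure"
  where "cube s = PiM {..<s} (\<lambda>_. restrict_space lborel {-1..1})"

definition multi_indices :: "nat \<Rightarrow> (nat \<Rightarrow> nat) set"
  where "multi_indices s = {..<s} \<rightarrow>\<^sub>E UNIV"

definition weight :: "real \<Rightarrow> real \<Rightarrow> nat \<Rightarrow> (nat \<Rightarrow> real) \<Rightarrow> real"
  where "weight \<alpha> \<beta> s x = (\<Prod>j<s. jacobi_weight \<alpha> \<beta> (x j))"

definition jacobi_multi :: "real \<Rightarrow> real \<Rightarrow> nat \<Rightarrow> (nat \<Rightarrow> nat) \<Rightarrow> (nat \<Rightarrow> real) \<Rightarrow> real"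
  where "jacobi_multi \<alpha> \<beta> s k x = (\<Prod>j<s. poly (jacobi \<alpha> \<beta> (k j)) (x j))"

text \<open>
  Elements of \<open>L\<^sub>2\<close> are represented by functions, without passing to classes modulo equality
  almost everywhere; \<open>L2_norm\<close> is thus a seminorm.
\<close>

definition L2_space :: "real \<Rightarrow> real \<Rightarrow> nat \<Rightarrow> ((nat \<Rightarrow> real) \<Rightarrow> real) set"
  where "L2_space \<alpha> \<beta> s =
    {f \<in> borel_measurable (cube s). integrable (cube s) (\<lambda>x. (f x)\<^sup>2 * weight \<alpha> \<beta> s x)}"

definition L2_inner ::
    "real \<Rightarrow> real \<Rightarrow> nat \<Rightarrow> ((nat \<Rightarrow> real) \<Rightarrow> real) \<Rightarrow> ((nat \<Rightarrow> real) \<Rightarrow> real) \<Rightarrow> real"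
  where "L2_inner \<alpha> \<beta> s f g = (LINT x | cube s. f x * g x * weight \<alpha> \<beta> s x)"

definition L2_norm :: "real \<Rightarrow> real \<Rightarrow> nat \<Rightarrow> ((nat \<Rightarrow> real) \<Rightarrow> real) \<Rightarrow> real"
  where "L2_norm \<alpha> \<beta> s f = sqrt (L2_inner \<alpha> \<beta> s f f)"

definition jacobi_coeff ::
    "real \<Rightarrow> real \<Rightarrow> nat \<Rightarrow> ((nat \<Rightarrow> real) \<Rightarrow> real) \<Rightarrow> (nat \<Rightarrow> nat) \<Rightarrow> real"
  where "jacobi_coeff \<alpha> \<beta> s f k = L2_inner \<alpha> \<beta> s f (jacobi_multi \<alpha> \<beta> s k)"

definition lam :: "real \<Rightarrow> nat \<Rightarrow> (nat \<Rightarrow> nat) \<Rightarrow> real"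
  where "lam a s k = (\<Prod>j<s. a + real (k j))"

definition K_space ::
    "real \<Rightarrow> real \<Rightarrow> real \<Rightarrow> real \<Rightarrow> nat \<Rightarrow> ((nat \<Rightarrow> real) \<Rightarrow> real) set"
  where "K_space \<alpha> \<beta> r a s =
    {f \<in> L2_space \<alpha> \<beta> s.
      (\<lambda>k. lam a s k powr (2 * r) * \<bar>jacobi_coeff \<alpha> \<beta> s f k\<bar>\<^sup>2) summable_on multi_indices s}"

definition K_norm ::
    "real \<Rightarrow> real \<Rightarrow> real \<Rightarrow> real \<Rightarrow> nat \<Rightarrow> ((nat \<Rightarrow> real) \<Rightarrow> real) \<Rightarrow> real"
  where "K_norm \<alpha> \<beta> r a s f =
    sqrt (\<Sum>\<^sub>\<infinity>k\<in>multi_indices s. lam a s k powr (2 * r) * \<bar>jacobi_coeff \<alpha> \<beta> s f k\<bar>\<^sup>2)"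

definition U_ball ::
    "real \<Rightarrow> real \<Rightarrow> real \<Rightarrow> real \<Rightarrow> nat \<Rightarrow> ((nat \<Rightarrow> real) \<Rightarrow> real) set"
  where "U_ball \<alpha> \<beta> r a s = {f \<in> K_space \<alpha> \<beta> r a s. K_norm \<alpha> \<beta> r a s f \<le> 1}"

definition n_eps :: "real \<Rightarrow> real \<Rightarrow> real \<Rightarrow> real \<Rightarrow> real \<Rightarrow> nat \<Rightarrow> enat"
  where "n_eps \<alpha> \<beta> r a \<epsilon> s =
    eps_dim \<epsilon> ((\<lambda>f. (a powr (r * real s)) *\<^sub>R f) ` U_ball \<alpha> \<beta> r a s)
      (L2_space \<alpha> \<beta> s) (L2_norm \<alpha> \<beta> s)"

end

theory Submission
  imports Defs
begin

text \<open>
  The tensor products of Jacobi polynomials form an orthonormal basis of \<open>L\<^sub>2\<close>, so the ball of radius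
  \<open>a\<^sup>r\<^sup>s\<close> is an ellipsoid with semi-axes \<open>\<rho>(k)\<^sup>-\<^sup>r\<close>, where \<open>\<rho>(k) = \<Prod>\<^sub>j (1 + k\<^sub>j / a)\<close>, and its
  \<open>\<epsilon>\<close>-dimension is the number of \<open>k\<close> with \<open>\<rho>(k)\<^sup>r < 1 / \<epsilon>\<close>. By Rankin's method this number is at most
  \<open>\<epsilon>\<^sup>-\<^sup>t (\<Sum>\<^sub>i (1 + i / a)\<^sup>-\<^sup>r\<^sup>t)\<^sup>s\<close> for every \<open>t\<close>; the inner sum tends to \<open>1\<close> as \<open>t \<rightarrow> \<infinity>\<close>, so the logarithm
  is \<open>o(1 / \<epsilon> + s)\<close>. On the other hand, the indices with \<open>m\<close> entries \<open>1\<close> and the others \<open>0\<close> all have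
  \<open>\<rho>(k) = (1 + 1 / a)\<^sup>m\<close>, so for a fixed small \<open>\<epsilon>\<close> the \<open>\<epsilon>\<close>-dimension is at least \<open>s choose m\<close>, where
  \<open>m\<close> can exceed any proposed exponent of \<open>s\<close>.
\<close>

section \<open>Square-integrable functions\<close>

text \<open>Completeness of the Jacobi system is the costly ingredient, and only one side uses it.
  The bound from above controls the whole error of an orthogonal projection, so every
  square-integrable function has to be a limit of finite expansions; the bound from below needs only
  orthonormality and one element of the ball orthogonal to the given subspace. For negative
  \<open>\<alpha>\<close> or \<open>\<beta>\<close> the weight is unbounded, yet integrable, and
  finite total mass is what turns uniform approximation by polynomials into approximation in norm.
  Weights are absorbed into measures, so the general theory deals with plain integrals of squares.

  A single exponent \<open>t\<close> in Rankin's bound leaves a factor exponential in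
  \<open>s\<close>. Weak tractability survives because \<open>t\<close> can be fixed from the
  desired rate \<eta> before \<epsilon> and \<open>s\<close> are known: \<open>s\<close> then
  contributes at most \<open>s * \<eta> / 2\<close> to the logarithm, and
  \<open>t * ln (1 / \<epsilon>)\<close> is negligible against
  \<open>1 / \<epsilon>\<close>.\<close>

definition sq_integrable :: "'a measure \<Rightarrow> ('a \<Rightarrow> real) \<Rightarrow> bool"
  where "sq_integrable M f \<longleftrightarrow> f \<in> borel_measurable M \<and> integrable M (\<lambda>x. (f x)\<^sup>2)"

lemma sq_integrable_measurable [measurable_dest]: "sq_integrable M f \<Longrightarrow> f \<in> borel_measurable M"
  by (simp add: sq_integrable_def)

lemma sq_integrable_square: "sq_integrable M f \<Longrightarrow> integrable M (\<lambda>x. (f x)\<^sup>2)"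
  by (simp add: sq_integrable_def)

lemma sq_integrable_mult:
  assumes "sq_integrable M f" "sq_integrable M g"
  shows "integrable M (\<lambda>x. f x * g x)"
proof (rule Bochner_Integration.integrable_bound)
  show "integrable M (\<lambda>x. (f x)\<^sup>2 + (g x)\<^sup>2)"
    using assms by (auto simp: sq_integrable_def)
  show "(\<lambda>x. f x * g x) \<in> borel_measurable M"
    using assms by (auto simp: sq_integrable_def)
  show "AE x in M. norm (f x * g x) \<le> norm ((f x)\<^sup>2 + (g x)\<^sup>2)"
  proof (rule AE_I2)
    fix x
    have "2 * (\<bar>f x\<bar> * \<bar>g x\<bar>) \<le> (f x)\<^sup>2 + (g x)\<^sup>2"
      using sum_squares_bound[of "\<bar>f x\<bar>" "\<bar>g x\<bar>"] by simp
    moreover have "0 \<le> \<bar>f x\<bar> * \<bar>g x\<bar>" by simp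
    ultimately show "norm (f x * g x) \<le> norm ((f x)\<^sup>2 + (g x)\<^sup>2)"
      unfolding real_norm_def abs_mult by linarith
  qed
qed

lemma sq_integrable_add:
  assumes "sq_integrable M f" "sq_integrable M g"
  shows "sq_integrable M (\<lambda>x. f x + g x)"
proof -
  have "integrable M (\<lambda>x. (f x)\<^sup>2 + (g x)\<^sup>2 + 2 * (f x * g x))"
    using assms sq_integrable_mult[OF assms] by (intro Bochner_Integration.integrable_add) (auto simp: sq_integrable_def)
  then show ?thesis
    using assms by (auto simp: sq_integrable_def power2_sum mult.assoc)
qed

lemma sq_integrable_cmult: "sq_integrable M f \<Longrightarrow> sq_integrable M (\<lambda>x. c * f x)"
  by (auto simp: sq_integrable_def power_mult_distrib)

lemma sq_integrable_zero: "sq_integrable M (\<lambda>x. 0)"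
  by (simp add: sq_integrable_def)

lemma sq_integrable_diff:
  assumes "sq_integrable M f" "sq_integrable M g"
  shows "sq_integrable M (\<lambda>x. f x - g x)"
  using sq_integrable_add[OF assms(1) sq_integrable_cmult[OF assms(2), of "-1"]] by simp

lemma sq_integrable_sum:
  "(\<And>k. k \<in> A \<Longrightarrow> sq_integrable M (e k)) \<Longrightarrow> sq_integrable M (\<lambda>x. \<Sum>k\<in>A. d k * e k x)"
  by (induction A rule: infinite_finite_induct)
     (auto intro!: sq_integrable_zero sq_integrable_add sq_integrable_cmult)

lemma sq_integrable_le:
  assumes "sq_integrable M g" "f \<in> borel_measurable M" "\<And>x. x \<in> space M \<Longrightarrow> \<bar>f x\<bar> \<le> \<bar>g x\<bar>"
  shows "sq_integrable M f"
  unfolding sq_integrable_def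
proof
  show "integrable M (\<lambda>x. (f x)\<^sup>2)"
    by (rule Bochner_Integration.integrable_bound[OF sq_integrable_square[OF assms(1)]])
       (use assms in \<open>auto intro!: AE_I2 simp: abs_le_square_iff\<close>)
qed fact

lemma subspace_sq_integrable: "subspace {f. sq_integrable M f}"
  unfolding subspace_def zero_fun_def plus_fun_def scaleR_fun_def
  by (auto intro: sq_integrable_zero sq_integrable_add sq_integrable_cmult)

text \<open>Replaces the triangle inequality in the density arguments: the factor 2 is harmless for
  limits, and no square roots appear.\<close>

lemma integral_square_add_le:
  assumes "sq_integrable M f" "sq_integrable M g"
  shows "(\<integral>x. (f x + g x)\<^sup>2 \<partial>M) \<le> 2 * (\<integral>x. (f x)\<^sup>2 \<partial>M) + 2 * (\<integral>x. (g x)\<^sup>2 \<partial>M)"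
proof -
  have "(\<integral>x. (f x + g x)\<^sup>2 \<partial>M) \<le> (\<integral>x. 2 * (f x)\<^sup>2 + 2 * (g x)\<^sup>2 \<partial>M)"
  proof (rule integral_mono)
    show "(f x + g x)\<^sup>2 \<le> 2 * (f x)\<^sup>2 + 2 * (g x)\<^sup>2" for x
      using zero_le_power2[of "f x - g x"] by (simp add: power2_sum power2_diff)
  qed (use assms sq_integrable_add[OF assms] in \<open>auto simp: sq_integrable_def\<close>)
  also have "\<dots> = 2 * (\<integral>x. (f x)\<^sup>2 \<partial>M) + 2 * (\<integral>x. (g x)\<^sup>2 \<partial>M)"
    using assms by (subst Bochner_Integration.integral_add) (auto simp: sq_integrable_def)
  finally show ?thesis .
qed

lemma integral_square_diff:
  assumes f: "sq_integrable M f" and g: "sq_integrable M g"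
  shows "(\<integral>x. (f x - g x)\<^sup>2 \<partial>M)
    = (\<integral>x. (f x)\<^sup>2 \<partial>M) - 2 * (\<integral>x. f x * g x \<partial>M) + (\<integral>x. (g x)\<^sup>2 \<partial>M)"
proof -
  have "(\<integral>x. (f x - g x)\<^sup>2 \<partial>M) = (\<integral>x. (f x)\<^sup>2 - 2 * (f x * g x) + (g x)\<^sup>2 \<partial>M)"
    by (simp add: power2_diff algebra_simps)
  also have "\<dots> = (\<integral>x. (f x)\<^sup>2 \<partial>M) - 2 * (\<integral>x. f x * g x \<partial>M) + (\<integral>x. (g x)\<^sup>2 \<partial>M)"
    using assms sq_integrable_mult[OF f g] by (simp add: sq_integrable_def)
  finally show ?thesis .
qed


section \<open>Density of a subspace of \<open>L\<^sub>2\<close>\<close>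

text \<open>Membership in the closure of \<open>V\<close>. Square integrability is demanded
  separately: the integral of a non-integrable function is 0 by default, which would make the second
  condition hold for the wrong reason.\<close>

definition L2_approx :: "'a measure \<Rightarrow> ('a \<Rightarrow> real) set \<Rightarrow> ('a \<Rightarrow> real) \<Rightarrow> bool"
  where "L2_approx M V f \<longleftrightarrow>
    sq_integrable M f \<and> (\<forall>\<epsilon>>0. \<exists>g\<in>V. (\<integral>x. (f x - g x)\<^sup>2 \<partial>M) < \<epsilon>)"

lemma L2_approxD:
  "L2_approx M V f \<Longrightarrow> 0 < \<epsilon> \<Longrightarrow> \<exists>g\<in>V. (\<integral>x. (f x - g x)\<^sup>2 \<partial>M) < \<epsilon>"
  by (simp add: L2_approx_def)

lemma L2_approx_sq: "L2_approx M V f \<Longrightarrow> sq_integrable M f"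
  by (simp add: L2_approx_def)

lemma L2_approx_cong:
  assumes "\<And>x. x \<in> space M \<Longrightarrow> f x = g x"
  shows "L2_approx M V f \<longleftrightarrow> L2_approx M V g"
proof -
  have "sq_integrable M f \<longleftrightarrow> sq_integrable M g"
    unfolding sq_integrable_def using assms
    by (intro conj_cong measurable_cong Bochner_Integration.integrable_cong) auto
  moreover have "(\<integral>x. (f x - h x)\<^sup>2 \<partial>M) = (\<integral>x. (g x - h x)\<^sup>2 \<partial>M)" for h
    using assms by (intro Bochner_Integration.integral_cong) auto
  ultimately show ?thesis
    by (simp add: L2_approx_def)
qed

locale L2_subspace = finite_measure M for M :: "'a measure" +
  fixes V :: "('a \<Rightarrow> real) set"
  assumes subspace_V: "subspace V"
    and sq_V: "g \<in> V \<Longrightarrow> sq_integrable M g"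
begin

lemma L2_approx_add:
  assumes "L2_approx M V f" "L2_approx M V f'"
  shows "L2_approx M V (\<lambda>x. f x + f' x)"
  unfolding L2_approx_def
proof (intro conjI allI impI)
  show "sq_integrable M (\<lambda>x. f x + f' x)"
    using assms by (intro sq_integrable_add) (auto dest: L2_approx_sq)
  fix \<epsilon> :: real assume "\<epsilon> > 0"
  \<comment> \<open>Quarters, because \<open>integral_square_add_le\<close> doubles each of the two
    errors.\<close>
  then obtain g g' where g: "g \<in> V" "(\<integral>x. (f x - g x)\<^sup>2 \<partial>M) < \<epsilon> / 4"
    and g': "g' \<in> V" "(\<integral>x. (f' x - g' x)\<^sup>2 \<partial>M) < \<epsilon> / 4"
    using L2_approxD[OF assms(1), of "\<epsilon> / 4"] L2_approxD[OF assms(2), of "\<epsilon> / 4"] by auto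
  have "(\<integral>x. (f x + f' x - (g + g') x)\<^sup>2 \<partial>M) = (\<integral>x. ((f x - g x) + (f' x - g' x))\<^sup>2 \<partial>M)"
    by (simp add: algebra_simps)
  also have "\<dots> < \<epsilon>"
    using integral_square_add_le[OF sq_integrable_diff[OF L2_approx_sq[OF assms(1)] sq_V[OF g(1)]]
        sq_integrable_diff[OF L2_approx_sq[OF assms(2)] sq_V[OF g'(1)]]] g(2) g'(2)
    by linarith
  finally show "\<exists>h\<in>V. (\<integral>x. (f x + f' x - h x)\<^sup>2 \<partial>M) < \<epsilon>"
    using subspace_add[OF subspace_V g(1) g'(1)] by blast
qed

lemma L2_approx_cmult:
  assumes "L2_approx M V f"
  shows "L2_approx M V (\<lambda>x. c * f x)"
  unfolding L2_approx_def
proof (intro conjI allI impI)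
  show "sq_integrable M (\<lambda>x. c * f x)"
    using assms by (intro sq_integrable_cmult) (auto dest: L2_approx_sq)
  fix \<epsilon> :: real assume "\<epsilon> > 0"
  then have "\<epsilon> / (c\<^sup>2 + 1) > 0"
    by (simp add: add_nonneg_pos)
  then obtain g where g: "g \<in> V" "(\<integral>x. (f x - g x)\<^sup>2 \<partial>M) < \<epsilon> / (c\<^sup>2 + 1)"
    using L2_approxD[OF assms] by blast
  have "(\<integral>x. (c * f x - (c *\<^sub>R g) x)\<^sup>2 \<partial>M) = (\<integral>x. c\<^sup>2 * (f x - g x)\<^sup>2 \<partial>M)"
    by (simp add: scaleR_fun_def power_mult_distrib flip: right_diff_distrib)
  also have "\<dots> = c\<^sup>2 * (\<integral>x. (f x - g x)\<^sup>2 \<partial>M)"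
    by simp
  also have "\<dots> \<le> (c\<^sup>2 + 1) * (\<integral>x. (f x - g x)\<^sup>2 \<partial>M)"
    by (intro mult_right_mono) auto
  also have "\<dots> < \<epsilon>"
    using g(2) by (simp add: pos_less_divide_eq add_nonneg_pos mult.commute)
  finally show "\<exists>h\<in>V. (\<integral>x. (c * f x - h x)\<^sup>2 \<partial>M) < \<epsilon>"
    using subspace_scale[OF subspace_V g(1)] by blast
qed

lemma L2_approx_diff:
  "L2_approx M V f \<Longrightarrow> L2_approx M V g \<Longrightarrow> L2_approx M V (\<lambda>x. f x - g x)"
  using L2_approx_add[OF _ L2_approx_cmult[of g "-1"]] by simp

lemma L2_approx_zero: "L2_approx M V (\<lambda>x. 0)"
  using subspace_0[OF subspace_V]
  by (auto simp: L2_approx_def sq_integrable_zero zero_fun_def intro!: bexI[of _ "\<lambda>x. 0"])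

lemma L2_approx_limit:
  assumes f: "sq_integrable M f" and u: "\<And>n. L2_approx M V (u n)"
    and lim: "(\<lambda>n. \<integral>x. (f x - u n x)\<^sup>2 \<partial>M) \<longlonglongrightarrow> 0"
  shows "L2_approx M V f"
  unfolding L2_approx_def
proof (intro conjI allI impI)
  fix \<epsilon> :: real assume "\<epsilon> > 0"
  then have "\<forall>\<^sub>F n in sequentially. (\<integral>x. (f x - u n x)\<^sup>2 \<partial>M) < \<epsilon> / 4"
    by (intro order_tendstoD[OF lim]) auto
  then obtain n where n: "(\<integral>x. (f x - u n x)\<^sup>2 \<partial>M) < \<epsilon> / 4"
    by (auto dest: eventually_happens)
  obtain g where g: "g \<in> V" "(\<integral>x. (u n x - g x)\<^sup>2 \<partial>M) < \<epsilon> / 4"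
    using L2_approxD[OF u, of "\<epsilon> / 4" n] \<open>\<epsilon> > 0\<close> by auto
  have "(\<integral>x. (f x - g x)\<^sup>2 \<partial>M) = (\<integral>x. ((f x - u n x) + (u n x - g x))\<^sup>2 \<partial>M)"
    by simp
  also have "\<dots> < \<epsilon>"
    using integral_square_add_le[OF sq_integrable_diff[OF f L2_approx_sq[OF u]]
        sq_integrable_diff[OF L2_approx_sq[OF u] sq_V[OF g(1)]], of n n] g(2) n
    by linarith
  finally show "\<exists>h\<in>V. (\<integral>x. (f x - h x)\<^sup>2 \<partial>M) < \<epsilon>"
    using g(1) by blast
qed (fact f)

text \<open>The limit inherits the bound by \<open>g\<close>, so the squared error is dominated by
  \<open>4 * (g x)\<^sup>2\<close> and its integral tends to 0.\<close>

lemma L2_approx_dominated: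
  assumes g: "sq_integrable M g" and f[measurable]: "f \<in> borel_measurable M"
    and u: "\<And>n. L2_approx M V (u n)"
    and lim: "\<And>x. x \<in> space M \<Longrightarrow> (\<lambda>n. u n x) \<longlonglongrightarrow> f x"
    and dom: "\<And>n x. x \<in> space M \<Longrightarrow> \<bar>u n x\<bar> \<le> \<bar>g x\<bar>"
  shows "L2_approx M V f"
proof (rule L2_approx_limit[OF _ u])
  have fg: "\<bar>f x\<bar> \<le> \<bar>g x\<bar>" if "x \<in> space M" for x
    by (rule LIMSEQ_le_const2[OF tendsto_rabs[OF lim[OF that]]]) (use dom[OF that] in auto)
  show "sq_integrable M f"
    by (rule sq_integrable_le[OF g f fg])
  have [measurable]: "u n \<in> borel_measurable M" for n
    using L2_approx_sq[OF u] by measurable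
  have "(\<lambda>n. \<integral>x. (f x - u n x)\<^sup>2 \<partial>M) \<longlonglongrightarrow> (\<integral>x. 0 \<partial>M)"
  proof (rule integral_dominated_convergence)
    show "integrable M (\<lambda>x. 4 * (g x)\<^sup>2)"
      using g by (simp add: sq_integrable_def)
    show "AE x in M. (\<lambda>n. (f x - u n x)\<^sup>2) \<longlonglongrightarrow> 0"
    proof (rule AE_I2)
      fix x assume "x \<in> space M"
      then have "(\<lambda>n. (f x - u n x)\<^sup>2) \<longlonglongrightarrow> (f x - f x)\<^sup>2"
        by (intro tendsto_intros lim)
      then show "(\<lambda>n. (f x - u n x)\<^sup>2) \<longlonglongrightarrow> 0" by simp
    qed
    show "AE x in M. norm ((f x - u n x)\<^sup>2) \<le> 4 * (g x)\<^sup>2" for n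
    proof (rule AE_I2)
      fix x assume x: "x \<in> space M"
      have "\<bar>f x - u n x\<bar> \<le> \<bar>2 * g x\<bar>"
        using fg[OF x] dom[OF x, of n] by linarith
      then show "norm ((f x - u n x)\<^sup>2) \<le> 4 * (g x)\<^sup>2"
        by (simp add: abs_le_square_iff power_mult_distrib)
    qed
  qed auto
  then show "(\<lambda>n. \<integral>x. (f x - u n x)\<^sup>2 \<partial>M) \<longlonglongrightarrow> 0" by simp
qed

text \<open>Dynkin's argument: the sets whose indicator lies in the closure are stable under
  complements (differences of indicators) and disjoint unions (bounded limits of partial sums). The
  whole space is a separate hypothesis because a generator such as the half-lines need not contain
  it.\<close>

lemma L2_approx_indicator:
  assumes G: "Int_stable G" "G \<subseteq> Pow (space M)" "sets M = sigma_sets (space M) G"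
    and space: "L2_approx M V (indicator (space M))"
    and gen: "\<And>A. A \<in> G \<Longrightarrow> L2_approx M V (indicator A)"
    and A: "A \<in> sets M"
  shows "L2_approx M V (indicator A)"
proof -
  have meas: "A \<in> sets M" if "A \<in> sigma_sets (space M) G" for A
    using that G by simp
  from A have "A \<in> sigma_sets (space M) G"
    using G by simp
  with G(1,2) show ?thesis
  proof (induction rule: sigma_sets_induct_disjoint)
    case (basic A)
    then show ?case by (rule gen)
  next
    case empty
    then show ?case using L2_approx_zero by simp
  next
    case (compl A)
    have eq: "indicator (space M - A) x = indicator (space M) x - (indicator A x :: real)" for x
      using meas[OF compl(1), THEN sets.sets_into_space] by (auto simp: indicator_def)
    show ?case
      unfolding eq[abs_def] by (rule L2_approx_diff[OF space compl(2)])
  next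
    case (union A)
    have Am: "A i \<in> sets M" for i
      using union(2) meas by auto
    show ?case
    proof (rule L2_approx_dominated[where g = "\<lambda>x. 1" and u = "\<lambda>n x. \<Sum>i<n. indicator (A i) x"])
      show "sq_integrable M (\<lambda>x. 1)" by (simp add: sq_integrable_def)
      show "indicator (\<Union> (range A)) \<in> borel_measurable M"
        using Am by auto
      show "L2_approx M V (\<lambda>x. \<Sum>i<n. indicator (A i) x)" for n
        by (induction n) (auto intro: L2_approx_zero L2_approx_add union(3))
      have part: "(\<Sum>i<n. indicator (A i) x :: real) = indicator (\<Union>i<n. A i) x" for n x
        using union(1) by (subst indicator_UN_disjoint) (auto simp: disjoint_family_on_def)
      show "\<bar>\<Sum>i<n. indicator (A i) x :: real\<bar> \<le> \<bar>1\<bar>" for n x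
        unfolding part by (auto simp: indicator_def)
      show "(\<lambda>n. \<Sum>i<n. indicator (A i) x :: real) \<longlonglongrightarrow> indicator (\<Union> (range A)) x" for x
        unfolding part by (rule LIMSEQ_indicator_UN)
    qed
  qed
qed

lemma L2_approx_all:
  assumes ind: "\<And>A. A \<in> sets M \<Longrightarrow> L2_approx M V (indicator A)"
    and f: "sq_integrable M f"
  shows "L2_approx M V f"
proof -
  \<comment> \<open>Square integrability is a premise inside the induction: the functions met on the
    way are only measurable, and each has to inherit it from the larger function built from it,
    which nonnegativity permits.\<close>
  have nonneg: "sq_integrable M f \<longrightarrow> L2_approx M V f"
    if "f \<in> borel_measurable M" "\<And>x. 0 \<le> f x" for f
    using that
  proof (induct rule: borel_measurable_induct_real)
    case (set A)
    then show ?case using ind by simp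
  next
    case (mult u c)
    show ?case
    \<comment> \<open>For \<open>c = 0\<close> the product is square-integrable without any
      information on \<open>u\<close>, so the induction hypothesis cannot be used.\<close>
    proof (cases "c = 0")
      case False
      then have "sq_integrable M u" if "sq_integrable M (\<lambda>x. c * u x)"
        using sq_integrable_cmult[OF that, of "1 / c"] by simp
      then show ?thesis
        using mult L2_approx_cmult by blast
    qed (simp add: L2_approx_zero)
  next
    case (add u v)
    have "sq_integrable M u" "sq_integrable M v" if "sq_integrable M (\<lambda>x. v x + u x)"
      by (rule sq_integrable_le[OF that]; use add in auto)+
    then show ?case
      using add L2_approx_add by blast
  next
    case (seq U)
    show ?case
    proof
      assume f: "sq_integrable M f"
      have le: "\<bar>U n x\<bar> \<le> \<bar>f x\<bar>" if "x \<in> space M" for n x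
        using incseq_le[OF _ seq(5)[OF that], of n] seq(4) seq(2)[of n x] that
        by (auto simp: incseq_def le_fun_def)
      show "L2_approx M V f"
      proof (rule L2_approx_dominated[OF f _ _ seq(5) le])
        show "L2_approx M V (U n)" for n
          using seq(3)[of n] sq_integrable_le[OF f seq(1) le] by blast
      qed (use f in measurable)
    qed
  qed
  have [measurable]: "f \<in> borel_measurable M"
    using f by measurable
  have "L2_approx M V (\<lambda>x. max 0 (f x))"
    by (rule nonneg[rule_format]) (auto intro: sq_integrable_le[OF f])
  moreover have "L2_approx M V (\<lambda>x. max 0 (- f x))"
    by (rule nonneg[rule_format]) (auto intro: sq_integrable_le[OF f])
  ultimately have "L2_approx M V (\<lambda>x. max 0 (f x) - max 0 (- f x))"
    by (rule L2_approx_diff)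
  moreover have "max 0 (f x) - max 0 (- f x) = f x" for x
    by simp
  ultimately show ?thesis by simp
qed

end


section \<open>Orthonormal families and the \<open>\<epsilon>\<close>-dimension\<close>

text \<open>Gaussian elimination: each equation that is not trivial on \<open>A\<close> is used to
  remove one unknown, and at least one unknown outlives all equations.\<close>

lemma underdetermined_system:
  fixes m :: "'k \<Rightarrow> 'b \<Rightarrow> real"
  assumes "finite B" "finite A" "card B < card A"
  shows "\<exists>d. (\<exists>k\<in>A. d k \<noteq> 0) \<and> (\<forall>b\<in>B. (\<Sum>k\<in>A. d k * m k b) = 0)"
  using assms
proof (induction B arbitrary: A m rule: finite_induct)
  case empty
  then have "A \<noteq> {}" by auto
  then show ?case by (intro exI[of _ "\<lambda>_. 1"]) auto
next
  case (insert b B)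
  show ?case
  proof (cases "\<forall>k\<in>A. m k b = 0")
    case True
    have "card B < card A" using insert by simp
    then obtain d where "\<exists>k\<in>A. d k \<noteq> 0" "\<forall>b\<in>B. (\<Sum>k\<in>A. d k * m k b) = 0"
      using insert.IH[OF insert.prems(1)] by blast
    with True show ?thesis by (intro exI[of _ d]) auto
  next
    case False
    then obtain l where l: "l \<in> A" "m l b \<noteq> 0" by blast
    \<comment> \<open>Equation \<open>b\<close> forces \<open>d l\<close> to be minus the sum of the
      \<open>d k * t k\<close>; substituting this into equation \<open>c\<close> leaves the
      coefficient \<open>m k c - t k * m l c\<close> at the unknown \<open>k\<close>.\<close>
    define t where "t k = m k b / m l b" for k
    have "card B < card (A - {l})"
      using insert l by simp
    then obtain d where d: "\<exists>k\<in>A - {l}. d k \<noteq> 0"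
      "\<forall>c\<in>B. (\<Sum>k\<in>A - {l}. d k * (m k c - t k * m l c)) = 0"
      using insert.IH[of "A - {l}" "\<lambda>k c. m k c - t k * m l c"] insert.prems by blast
    define d' where "d' = d(l := - (\<Sum>k\<in>A - {l}. d k * t k))"
    have eq: "(\<Sum>k\<in>A. d' k * m k c) = (\<Sum>k\<in>A - {l}. d k * (m k c - t k * m l c))" for c
    proof -
      have "(\<Sum>k\<in>A. d' k * m k c) = d' l * m l c + (\<Sum>k\<in>A - {l}. d' k * m k c)"
        using insert.prems l by (subst sum.remove[of A l]) auto
      also have "(\<Sum>k\<in>A - {l}. d' k * m k c) = (\<Sum>k\<in>A - {l}. d k * m k c)"
        by (intro sum.cong) (auto simp: d'_def)
      finally show ?thesis
        by (simp add: d'_def sum_subtractf algebra_simps sum_distrib_left sum_distrib_right)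
    qed
    have "(\<Sum>k\<in>A. d' k * m k b) = 0"
      unfolding eq using l by (intro sum.neutral) (auto simp: t_def)
    moreover have "\<forall>c\<in>B. (\<Sum>k\<in>A. d' k * m k c) = 0"
      using d(2) by (simp add: eq)
    moreover have "\<exists>k\<in>A. d' k \<noteq> 0"
      using d(1) by (auto simp: d'_def)
    ultimately show ?thesis by blast
  qed
qed

text \<open>Coefficients are attached to indices rather than to vectors, since \<open>e\<close> is
  not assumed injective.\<close>

lemma span_image_sum:
  fixes e :: "'k \<Rightarrow> 'a \<Rightarrow> real"
  assumes "g \<in> span (e ` I)"
  shows "\<exists>A d. finite A \<and> A \<subseteq> I \<and> (\<forall>x. g x = (\<Sum>k\<in>A. d k * e k x))"
  using assms
proof (induction rule: span_induct_alt)
  case base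
  show ?case by (intro exI[of _ "{}"]) (simp add: zero_fun_def)
next
  case (step c h g)
  then obtain k A d where k: "h = e k" "k \<in> I" and A: "finite A" "A \<subseteq> I"
    and g: "\<And>x. g x = (\<Sum>k\<in>A. d k * e k x)" by auto
  \<comment> \<open>The values of \<open>d\<close> outside \<open>A\<close> are arbitrary; set to 0,
    they allow the same formula whether or not \<open>k\<close> already belongs to
    \<open>A\<close>.\<close>
  define d' where "d' = (\<lambda>j. if j \<in> A then d j else 0)"
  have "(c *\<^sub>R h + g) x = (\<Sum>j\<in>insert k A. (d'(k := d' k + c)) j * e j x)" for x
  proof -
    have "g x = (\<Sum>j\<in>insert k A. d' j * e j x)"
      unfolding g using A by (intro sum.mono_neutral_cong_left) (auto simp: d'_def)
    moreover have "(\<Sum>j\<in>insert k A. (d'(k := d' k + c)) j * e j x)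
        = (\<Sum>j\<in>insert k A. d' j * e j x + (if j = k then c * e k x else 0))"
      by (intro sum.cong) (auto simp: algebra_simps)
    ultimately show ?thesis
      using A by (simp add: sum.distrib scaleR_fun_def k)
  qed
  then show ?case
    using A k by (intro exI[of _ "insert k A"] exI[of _ "d'(k := d' k + c)"]) auto
qed

locale L2_orthonormal =
  fixes M :: "'a measure" and I :: "'k set" and e :: "'k \<Rightarrow> 'a \<Rightarrow> real"
  assumes sq_e: "k \<in> I \<Longrightarrow> sq_integrable M (e k)"
    and orthonormal: "j \<in> I \<Longrightarrow> k \<in> I \<Longrightarrow> (\<integral>x. e j x * e k x \<partial>M) = (if j = k then 1 else 0)"
begin

definition fcoeff :: "('a \<Rightarrow> real) \<Rightarrow> 'k \<Rightarrow> real"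
  where "fcoeff f k = (\<integral>x. f x * e k x \<partial>M)"

lemma sq_sum: "A \<subseteq> I \<Longrightarrow> sq_integrable M (\<lambda>x. \<Sum>k\<in>A. d k * e k x)"
  by (intro sq_integrable_sum sq_e) auto

lemma integral_mult_sum:
  assumes f: "sq_integrable M f" and A: "A \<subseteq> I"
  shows "(\<integral>x. f x * (\<Sum>k\<in>A. d k * e k x) \<partial>M) = (\<Sum>k\<in>A. d k * fcoeff f k)"
proof -
  have "(\<integral>x. f x * (\<Sum>k\<in>A. d k * e k x) \<partial>M) = (\<integral>x. (\<Sum>k\<in>A. d k * (f x * e k x)) \<partial>M)"
    by (simp add: sum_distrib_left mult_ac)
  also have "\<dots> = (\<Sum>k\<in>A. d k * fcoeff f k)"
    unfolding fcoeff_def using f A by (subst Bochner_Integration.integral_sum)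
      (auto intro!: sq_integrable_mult sq_e Bochner_Integration.integrable_mult_right)
  finally show ?thesis .
qed

lemma fcoeff_sum:
  assumes "finite A" "A \<subseteq> I" "k \<in> I"
  shows "fcoeff (\<lambda>x. \<Sum>k\<in>A. d k * e k x) k = (if k \<in> A then d k else 0)"
proof -
  have "fcoeff (\<lambda>x. \<Sum>k\<in>A. d k * e k x) k = (\<Sum>j\<in>A. d j * fcoeff (e k) j)"
    using integral_mult_sum[OF sq_e[OF assms(3)] assms(2), of d] by (simp add: fcoeff_def mult.commute)
  also have "\<dots> = (\<Sum>j\<in>A. if j = k then d k else 0)"
    using assms by (intro sum.cong) (auto simp: fcoeff_def orthonormal)
  finally show ?thesis
    using assms(1) by simp
qed

lemma integral_square_sum:
  assumes "finite A" "A \<subseteq> I"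
  shows "(\<integral>x. (\<Sum>k\<in>A. d k * e k x)\<^sup>2 \<partial>M) = (\<Sum>k\<in>A. (d k)\<^sup>2)"
proof -
  have "(\<integral>x. (\<Sum>k\<in>A. d k * e k x)\<^sup>2 \<partial>M) =
      (\<Sum>j\<in>A. d j * fcoeff (\<lambda>x. \<Sum>k\<in>A. d k * e k x) j)"
    unfolding power2_eq_square by (rule integral_mult_sum[OF sq_sum[OF assms(2)] assms(2)])
  also have "\<dots> = (\<Sum>k\<in>A. (d k)\<^sup>2)"
    using assms by (intro sum.cong) (auto simp: fcoeff_sum[OF assms] subsetD power2_eq_square)
  finally show ?thesis .
qed

text \<open>Completing the square. Only the last sum depends on \<open>d\<close>, so the Fourier
  coefficients are optimal, and dropping that sum bounds every approximation error from
  below.\<close>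

lemma integral_square_diff_sum:
  assumes f: "sq_integrable M f" and A: "finite A" "A \<subseteq> I"
  shows "(\<integral>x. (f x - (\<Sum>k\<in>A. d k * e k x))\<^sup>2 \<partial>M)
    = (\<integral>x. (f x)\<^sup>2 \<partial>M) - (\<Sum>k\<in>A. (fcoeff f k)\<^sup>2) + (\<Sum>k\<in>A. (fcoeff f k - d k)\<^sup>2)"
proof -
  have "(\<Sum>k\<in>A. (fcoeff f k - d k)\<^sup>2)
      = (\<Sum>k\<in>A. (fcoeff f k)\<^sup>2) - 2 * (\<Sum>k\<in>A. d k * fcoeff f k) + (\<Sum>k\<in>A. (d k)\<^sup>2)"
    by (simp add: power2_diff sum.distrib sum_subtractf sum_distrib_left mult_ac)
  then show ?thesis
    unfolding integral_square_diff[OF f sq_sum[OF A(2)]] integral_mult_sum[OF f A(2)]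
      integral_square_sum[OF A] by simp
qed

lemma integral_square_diff_projection:
  assumes f: "sq_integrable M f" and A: "finite A" "A \<subseteq> I"
  shows "(\<integral>x. (f x - (\<Sum>k\<in>A. fcoeff f k * e k x))\<^sup>2 \<partial>M)
    = (\<integral>x. (f x)\<^sup>2 \<partial>M) - (\<Sum>k\<in>A. (fcoeff f k)\<^sup>2)"
  using integral_square_diff_sum[OF assms, of "fcoeff f"] by simp

text \<open>A sphere of radius \<delta> in \<open>card A\<close> dimensions defeats every subspace
  of smaller dimension: some point of the sphere is orthogonal to the subspace and hence has
  distance at least \<delta> from it.\<close>

lemma eps_dim_ge:
  assumes N: "\<And>f. sq_integrable M f \<Longrightarrow> N f = sqrt (\<integral>x. (f x)\<^sup>2 \<partial>M)"
    and A: "finite A" "A \<subseteq> I"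
    and \<delta>: "0 \<le> \<epsilon>" "\<epsilon> < \<delta>"
    and W: "\<And>d. (\<Sum>k\<in>A. (d k)\<^sup>2) = \<delta>\<^sup>2 \<Longrightarrow> (\<lambda>x. \<Sum>k\<in>A. d k * e k x) \<in> W"
  shows "enat (card A) \<le> eps_dim \<epsilon> W {f. sq_integrable M f} N"
  unfolding eps_dim_def
proof (rule Inf_greatest, clarsimp, rule ccontr)
  fix n L
  assume L: "L \<subseteq> {f. sq_integrable M f}" "dim_at_most n L"
    and sup: "(SUP f\<in>W. INF g\<in>L. ereal (N (f - g))) \<le> ereal \<epsilon>"
    and n: "\<not> card A \<le> n"
  obtain B where B: "finite B" "span B = L" "card B \<le> n"
    using L(2) by (auto simp: dim_at_most_def)
  \<comment> \<open>The unknowns are the coefficients of a combination of the \<open>e k\<close>;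
    each basis element \<open>b\<close> of \<open>L\<close> contributes one equation, orthogonality
    to \<open>b\<close>.\<close>
  obtain d where d: "\<exists>k\<in>A. d k \<noteq> 0" "\<forall>b\<in>B. (\<Sum>k\<in>A. d k * fcoeff b k) = 0"
    using underdetermined_system[of B A "\<lambda>k b. fcoeff b k"] B A n by auto
  define S where "S = (\<Sum>k\<in>A. (d k)\<^sup>2)"
  have "S > 0"
    unfolding S_def using d(1) A(1) by (auto intro: sum_pos2)
  \<comment> \<open>Rescaling moves the nonzero solution to the sphere of radius \<delta>.\<close>
  define c where "c k = \<delta> / sqrt S * d k" for k
  define f where "f = (\<lambda>x. \<Sum>k\<in>A. c k * e k x)"
  have c: "(\<Sum>k\<in>A. (c k)\<^sup>2) = \<delta>\<^sup>2"
  proof -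
    have "(\<Sum>k\<in>A. (c k)\<^sup>2) = (\<Sum>k\<in>A. (\<delta> / sqrt S)\<^sup>2 * (d k)\<^sup>2)"
      by (simp only: c_def power_mult_distrib)
    also have "\<dots> = (\<delta> / sqrt S)\<^sup>2 * S"
      by (simp only: S_def sum_distrib_left)
    finally show ?thesis
      using \<open>S > 0\<close> by (simp add: power_divide)
  qed
  have f: "sq_integrable M f" "(\<integral>x. (f x)\<^sup>2 \<partial>M) = \<delta>\<^sup>2"
    unfolding f_def using A by (auto simp: sq_sum integral_square_sum c)
  have "subspace {g. sq_integrable M g \<and> (\<integral>x. g x * f x \<partial>M) = 0}"
    using sq_integrable_mult[OF _ f(1)]
    unfolding subspace_def zero_fun_def plus_fun_def scaleR_fun_def
    by (auto intro: sq_integrable_zero sq_integrable_add sq_integrable_cmult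
        simp: distrib_right mult.assoc)
  moreover have "B \<subseteq> {g. sq_integrable M g \<and> (\<integral>x. g x * f x \<partial>M) = 0}"
  proof clarify
    fix b assume b: "b \<in> B"
    then have sq: "sq_integrable M b"
      using B(2) L(1) span_base by blast
    have "(\<integral>x. b x * f x \<partial>M) = (\<Sum>k\<in>A. c k * fcoeff b k)"
      unfolding f_def by (rule integral_mult_sum[OF sq A(2)])
    also have "\<dots> = \<delta> / sqrt S * (\<Sum>k\<in>A. d k * fcoeff b k)"
      by (simp add: c_def sum_distrib_left mult_ac)
    finally show "sq_integrable M b \<and> (\<integral>x. b x * f x \<partial>M) = 0"
      using d(2) b sq by simp
  qed
  ultimately have orth: "L \<subseteq> {g. sq_integrable M g \<and> (\<integral>x. g x * f x \<partial>M) = 0}"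
    unfolding B(2)[symmetric] by (rule span_minimal[rotated])
  \<comment> \<open>By orthogonality the squared distance from \<open>f\<close> to \<open>g\<close>
    is the sum of their squared norms, so the best choice in \<open>L\<close> gains nothing over
    0.\<close>
  have "ereal \<delta> \<le> (INF g\<in>L. ereal (N (f - g)))"
  proof (rule INF_greatest)
    fix g assume "g \<in> L"
    then have g: "sq_integrable M g" "(\<integral>x. f x * g x \<partial>M) = 0"
      using orth by (auto simp: mult.commute)
    have "\<delta>\<^sup>2 \<le> (\<integral>x. (f x - g x)\<^sup>2 \<partial>M)"
      using integral_square_diff[OF f(1) g(1)] f(2) g(2) by simp
    then have "\<delta> \<le> sqrt (\<integral>x. (f x - g x)\<^sup>2 \<partial>M)"
      by (rule real_le_rsqrt)
    then show "ereal \<delta> \<le> ereal (N (f - g))"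
      using N[of "f - g"] sq_integrable_diff[OF f(1) g(1)] by (simp add: fun_diff_def)
  qed
  also have "\<dots> \<le> (SUP f\<in>W. INF g\<in>L. ereal (N (f - g)))"
    by (rule SUP_upper) (use W[OF c] in \<open>simp add: f_def\<close>)
  finally show False
    using sup \<delta> by (auto dest: order_trans)
qed

end

locale L2_basis = L2_orthonormal +
  assumes total: "sq_integrable M f \<Longrightarrow> L2_approx M (span (e ` I)) f"
begin

text \<open>Parseval's identity up to an error, with finite sums only. Enlarging the index set never
  increases the defect, so the indices of a good approximant can be joined to a prescribed set
  \<open>A\<close>.\<close>

lemma parseval_approx:
  assumes f: "sq_integrable M f" and A: "finite A" "A \<subseteq> I" and "\<epsilon> > 0"
  shows "\<exists>B. finite B \<and> A \<subseteq> B \<and> B \<subseteq> I \<and> (\<integral>x. (f x)\<^sup>2 \<partial>M) - (\<Sum>k\<in>B. (fcoeff f k)\<^sup>2) < \<epsilon>"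
proof -
  obtain g where g: "g \<in> span (e ` I)" "(\<integral>x. (f x - g x)\<^sup>2 \<partial>M) < \<epsilon>"
    using L2_approxD[OF total[OF f] \<open>\<epsilon> > 0\<close>] by blast
  obtain B d where B: "finite B" "B \<subseteq> I" "\<And>x. g x = (\<Sum>k\<in>B. d k * e k x)"
    using span_image_sum[OF g(1)] by blast
  have "(\<integral>x. (f x)\<^sup>2 \<partial>M) - (\<Sum>k\<in>A \<union> B. (fcoeff f k)\<^sup>2)
      \<le> (\<integral>x. (f x)\<^sup>2 \<partial>M) - (\<Sum>k\<in>B. (fcoeff f k)\<^sup>2)"
    using A B by (simp add: sum_mono2)
  also have "\<dots> \<le> (\<integral>x. (f x - g x)\<^sup>2 \<partial>M)"
    unfolding B(3) integral_square_diff_sum[OF f B(1,2)] by (simp add: sum_nonneg)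
  finally show ?thesis
    using A B g(2) by (intro exI[of _ "A \<union> B"]) auto
qed

text \<open>The subspace is spanned by the \<open>e k\<close> with \<open>k\<close> in
  \<open>A\<close>, and the approximant is the orthogonal projection; its squared error is the
  Parseval tail outside \<open>A\<close>.\<close>

lemma eps_dim_le:
  assumes N: "\<And>f. sq_integrable M f \<Longrightarrow> N f = sqrt (\<integral>x. (f x)\<^sup>2 \<partial>M)"
    and A: "finite A" "A \<subseteq> I" and "\<epsilon> \<ge> 0"
    and W: "\<And>f. f \<in> W \<Longrightarrow> sq_integrable M f"
    and tail: "\<And>f B. f \<in> W \<Longrightarrow> finite B \<Longrightarrow> B \<subseteq> I - A \<Longrightarrow> (\<Sum>k\<in>B. (fcoeff f k)\<^sup>2) \<le> \<epsilon>\<^sup>2"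
  shows "eps_dim \<epsilon> W {f. sq_integrable M f} N \<le> enat (card A)"
proof -
  define L where "L = span (e ` A)"
  have "L \<subseteq> {f. sq_integrable M f}"
    unfolding L_def using A sq_e by (intro span_minimal subspace_sq_integrable) auto
  moreover have "dim_at_most (card A) L"
  proof -
    \<comment> \<open>An upper bound on the dimension is enough, so a maximal independent subset is
      taken instead of proving the family independent.\<close>
    obtain B where B: "B \<subseteq> e ` A" "independent B" "e ` A \<subseteq> span B"
      using maximal_independent_subset[of "e ` A"] by blast
    have "span B = L"
      unfolding L_def using B(1,3) by (meson span_eq span_superset subset_trans)
    moreover have "finite B" "card B \<le> card A"
      using B(1) A(1) by (auto intro: finite_subset surj_card_le)
    ultimately show ?thesis
      using B(2) by (auto simp: dim_at_most_def)
  qed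
  moreover have "(SUP f\<in>W. INF g\<in>L. ereal (N (f - g))) \<le> ereal \<epsilon>"
  proof (rule SUP_least)
    fix f assume fW: "f \<in> W"
    then have f: "sq_integrable M f" by (rule W)
    define g where "g = (\<lambda>x. \<Sum>k\<in>A. fcoeff f k * e k x)"
    have "g = (\<Sum>k\<in>A. fcoeff f k *\<^sub>R e k)"
    proof
      show "g x = (\<Sum>k\<in>A. fcoeff f k *\<^sub>R e k) x" for x
        unfolding g_def using A(1)
        by (induction A rule: finite_induct) (auto simp: scaleR_fun_def)
    qed
    then have "g \<in> L"
      by (simp only: L_def) (intro span_sum span_scale span_base imageI)
    \<comment> \<open>The assumption \<open>tail\<close> concerns finite sets only, so the full tail
      is reached through \<open>parseval_approx\<close> with an arbitrarily small loss
      \<eta>.\<close>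
    have "(\<integral>x. (f x)\<^sup>2 \<partial>M) - (\<Sum>k\<in>A. (fcoeff f k)\<^sup>2) \<le> \<epsilon>\<^sup>2 + \<eta>" if "\<eta> > 0" for \<eta>
    proof -
      obtain B where B: "finite B" "A \<subseteq> B" "B \<subseteq> I"
        "(\<integral>x. (f x)\<^sup>2 \<partial>M) - (\<Sum>k\<in>B. (fcoeff f k)\<^sup>2) < \<eta>"
        using parseval_approx[OF f A \<open>\<eta> > 0\<close>] by blast
      have "(\<Sum>k\<in>B. (fcoeff f k)\<^sup>2) = (\<Sum>k\<in>B - A. (fcoeff f k)\<^sup>2) + (\<Sum>k\<in>A. (fcoeff f k)\<^sup>2)"
        using B by (intro sum.subset_diff) auto
      then show ?thesis
        using tail[OF fW, of "B - A"] B(1,3,4) Diff_mono[OF B(3) order_refl] by auto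
    qed
    then have "(\<integral>x. (f x - g x)\<^sup>2 \<partial>M) \<le> \<epsilon>\<^sup>2"
      unfolding g_def integral_square_diff_projection[OF f A] by (rule field_le_epsilon)
    then have "N (f - g) \<le> \<epsilon>"
      using N[of "f - g"] sq_integrable_diff[OF f sq_sum[OF A(2)], of "fcoeff f"] \<open>\<epsilon> \<ge> 0\<close>
      by (simp add: g_def fun_diff_def real_le_lsqrt)
    then show "(INF g\<in>L. ereal (N (f - g))) \<le> ereal \<epsilon>"
      using \<open>g \<in> L\<close> by (intro INF_lower2[of g]) auto
  qed
  ultimately show ?thesis
    unfolding eps_dim_def by (intro Inf_lower imageI) (auto simp: L_def intro!: exI[of _ L])
qed

end


section \<open>Orthonormal polynomials\<close>

locale poly_inner_product =
  fixes ip :: "real poly \<Rightarrow> real poly \<Rightarrow> real"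
  assumes ip_add: "ip (p + p') q = ip p q + ip p' q"
    and ip_smult: "ip (smult c p) q = c * ip p q"
    and ip_commute: "ip p q = ip q p"
    and ip_pos: "p \<noteq> 0 \<Longrightarrow> ip p p > 0"
begin

lemma ip_zero: "ip 0 q = 0"
  using ip_smult[of 0 0 q] by simp

lemma ip_diff: "ip (p - p') q = ip p q - ip p' q"
  using ip_add[of p "smult (-1) p'" q] ip_smult[of "-1" p' q] by simp

lemma ip_smult_right: "ip p (smult c q) = c * ip p q"
  by (metis ip_commute ip_smult)

lemma ip_add_right: "ip p (q + q') = ip p q + ip p q'"
  by (metis ip_commute ip_add)

text \<open>Polynomials of degree less than \<open>n\<close>, described by coefficients so that
  \<open>n = 0\<close> gives the zero space; since the zero polynomial has degree 0,
  \<open>degree q < n\<close> would give the empty set there.\<close>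

definition polys_below :: "nat \<Rightarrow> real poly set"
  where "polys_below n = {q. \<forall>i\<ge>n. coeff q i = 0}"

lemma polys_below_step:
  assumes u: "u \<in> polys_below (Suc n)" and v: "v \<in> polys_below (Suc n)" "coeff v n \<noteq> 0"
  shows "u - smult (coeff u n / coeff v n) v \<in> polys_below n"
  unfolding polys_below_def
proof safe
  fix i assume "n \<le> i"
  then show "coeff (u - smult (coeff u n / coeff v n) v) i = 0"
    using assms by (cases "i = n") (auto simp: polys_below_def)
qed

text \<open>One Gram-Schmidt step per degree. The induction is over all \<open>p\<close> at once
  because it needs the projection of \<open>p\<close> and also that of the monomial of degree
  \<open>n\<close>, whose remainder \<open>e\<close> is the new orthogonal direction.\<close>

lemma projection_exists: "\<exists>q\<in>polys_below n. \<forall>u\<in>polys_below n. ip (p - q) u = 0"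
proof (induction n arbitrary: p)
  case 0
  have "polys_below 0 = {0}"
    by (auto simp: polys_below_def poly_eq_iff)
  then show ?case
    using ip_zero by (auto simp: ip_commute[of _ 0])
next
  case (Suc n)
  obtain q0 where q0: "q0 \<in> polys_below n" "\<forall>u\<in>polys_below n. ip (monom 1 n - q0) u = 0"
    using Suc.IH by blast
  obtain q where q: "q \<in> polys_below n" "\<forall>u\<in>polys_below n. ip (p - q) u = 0"
    using Suc.IH by blast
  define e where "e = monom 1 n - q0"
  have cn: "coeff e n = 1" and e: "e \<in> polys_below (Suc n)"
    using q0(1) by (auto simp: e_def polys_below_def)
  have "e \<noteq> 0" using cn by auto
  then have ee: "ip e e > 0" by (rule ip_pos)
  define r where "r = q + smult (ip p e / ip e e) e"
  have qe: "ip q e = 0"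
    using q0(2) q(1) by (simp add: e_def ip_commute)
  have re: "ip (p - r) e = 0"
    using ee by (simp add: r_def ip_diff ip_add ip_smult qe)
  have rn: "ip (p - r) u = 0" if "u \<in> polys_below n" for u
  proof -
    have "p - r = (p - q) - smult (ip p e / ip e e) e"
      by (simp add: r_def)
    moreover have "ip (p - q) u = 0" "ip e u = 0"
      using q(2) q0(2) that by (auto simp: e_def)
    ultimately show ?thesis
      by (simp only: ip_diff[of "p - q"] ip_smult)
  qed
  have "ip (p - r) u = 0" if "u \<in> polys_below (Suc n)" for u
  proof -
    define v where "v = u - smult (coeff u n / coeff e n) e"
    have "v \<in> polys_below n"
      unfolding v_def using that e cn by (intro polys_below_step) auto
    moreover have "u = v + smult (coeff u n / coeff e n) e"
      by (simp add: v_def)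
    ultimately show ?thesis
      using rn re by (metis ip_add_right ip_smult_right add_0 mult_zero_right)
  qed
  moreover have "r \<in> polys_below (Suc n)"
    using q(1) e by (auto simp: r_def polys_below_def)
  ultimately show ?case by blast
qed

definition orthonormal_polys :: "(nat \<Rightarrow> real poly) \<Rightarrow> bool"
  where "orthonormal_polys P \<longleftrightarrow> (\<forall>k. degree (P k) = k \<and> 0 < lead_coeff (P k)) \<and>
    (\<forall>j k. ip (P j) (P k) = (if j = k then 1 else 0))"

text \<open>\<open>P n\<close> is the monomial of degree \<open>n\<close> minus its projection to
  lower degrees, divided by its norm. Of two different members, the one of lower degree lies in the
  space to which the other is orthogonal.\<close>

lemma orthonormal_polys_exist: "\<exists>P. orthonormal_polys P"
proof -
  have "\<exists>p. degree p = n \<and> 0 < lead_coeff p \<and> ip p p = 1 \<and> (\<forall>u\<in>polys_below n. ip p u = 0)" for n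
  proof -
    obtain q where q: "q \<in> polys_below n" "\<forall>u\<in>polys_below n. ip (monom 1 n - q) u = 0"
      using projection_exists by blast
    define e where "e = monom 1 n - q"
    have c: "coeff e n = 1" "\<And>i. i > n \<Longrightarrow> coeff e i = 0"
      using q(1) by (auto simp: e_def polys_below_def)
    then have deg: "degree e = n"
      by (intro antisym degree_le le_degree) auto
    have "e \<noteq> 0" using c by auto
    then have ee: "ip e e > 0" by (rule ip_pos)
    define p where "p = smult (1 / sqrt (ip e e)) e"
    have "degree p = n" "0 < lead_coeff p" "ip p p = 1" "\<forall>u\<in>polys_below n. ip p u = 0"
      using ee deg c q(2) by (auto simp: p_def ip_smult ip_smult_right e_def)
    then show ?thesis by blast
  qed
  then obtain P where P: "\<And>n. degree (P n) = n" "\<And>n. 0 < lead_coeff (P n)" "\<And>n. ip (P n) (P n) = 1"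
    "\<And>n u. u \<in> polys_below n \<Longrightarrow> ip (P n) u = 0" by metis
  have below: "P j \<in> polys_below k" if "j < k" for j k
    using that P(1)[of j] by (auto simp: polys_below_def intro!: coeff_eq_0)
  have "ip (P j) (P k) = 0" if "j \<noteq> k" for j k
    using that below P(4) ip_commute by (metis nat_neq_iff)
  then show ?thesis
    using P by (intro exI[of _ P]) (auto simp: orthonormal_polys_def)
qed

lemma orthonormal_polys_below:
  assumes "orthonormal_polys P"
  shows "P n \<in> polys_below (Suc n)" "coeff (P n) n > 0"
proof -
  have deg: "degree (P n) = n" and lead: "0 < lead_coeff (P n)"
    using assms unfolding orthonormal_polys_def by blast+
  show "P n \<in> polys_below (Suc n)"
    using deg by (auto simp: polys_below_def intro!: coeff_eq_0)
  show "coeff (P n) n > 0"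
    using lead unfolding deg .
qed

lemma orthonormal_polys_span:
  assumes P: "orthonormal_polys P" and "u \<in> polys_below n"
  shows "\<exists>c. u = (\<Sum>i<n. smult (c i) (P i))"
  using assms(2)
proof (induction n arbitrary: u)
  case 0
  then show ?case by (auto simp: polys_below_def poly_eq_iff)
next
  case (Suc n)
  define t where "t = coeff u n / coeff (P n) n"
  have "u - smult t (P n) \<in> polys_below n"
    unfolding t_def using orthonormal_polys_below[OF P, of n] Suc.prems
    by (intro polys_below_step) auto
  then obtain c where c: "u - smult t (P n) = (\<Sum>i<n. smult (c i) (P i))"
    using Suc.IH by blast
  have "u = (\<Sum>i<n. smult (c i) (P i)) + smult t (P n)"
    by (simp flip: c)
  also have "\<dots> = (\<Sum>i<Suc n. smult ((c(n := t)) i) (P i))"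
    by simp
  finally show ?case by blast
qed

lemma orthonormal_polys_orth:
  assumes P: "orthonormal_polys P" and u: "u \<in> polys_below n"
  shows "ip (P n) u = 0"
proof -
  obtain c where c: "u = (\<Sum>i<n. smult (c i) (P i))"
    using orthonormal_polys_span[OF assms] by blast
  have "ip (\<Sum>i\<in>A. smult (c i) (P i)) q = (\<Sum>i\<in>A. c i * ip (P i) q)" for A :: "nat set" and q
    by (induction A rule: infinite_finite_induct) (auto simp: ip_zero ip_add ip_smult)
  then have "ip u (P n) = (\<Sum>i<n. c i * ip (P i) (P n))"
    by (simp add: c)
  also have "\<dots> = 0"
    using P by (intro sum.neutral) (auto simp: orthonormal_polys_def)
  finally show ?thesis
    by (simp add: ip_commute)
qed

lemma orthonormal_polys_unique:
  assumes P: "orthonormal_polys P" and Q: "orthonormal_polys Q"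
  shows "P = Q"
proof
  fix n
  define t where "t = coeff (Q n) n / coeff (P n) n"
  define d where "d = Q n - smult t (P n)"
  note below = orthonormal_polys_below[OF P, of n] orthonormal_polys_below[OF Q, of n]
  have t: "t > 0"
    using below by (simp add: t_def)
  \<comment> \<open>The leading terms cancel, so \<open>d\<close> has lower degree and is orthogonal
    to both \<open>P n\<close> and \<open>Q n\<close>; being a combination of them, it is orthogonal
    to itself.\<close>
  have "d \<in> polys_below n"
    unfolding d_def t_def using below by (intro polys_below_step) auto
  then have "ip d d = 0"
    using orthonormal_polys_orth[OF P, of d n] orthonormal_polys_orth[OF Q, of d n]
    by (subst d_def) (simp add: ip_diff ip_smult)
  then have "d = 0" using ip_pos[of d] by fastforce
  then have eq: "Q n = smult t (P n)" by (simp add: d_def)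
  moreover have "ip (P n) (P n) = 1" "ip (Q n) (Q n) = 1"
    using P Q by (auto simp: orthonormal_polys_def)
  ultimately have "t\<^sup>2 = 1"
    by (simp add: ip_smult ip_smult_right power2_eq_square)
  then have "t = 1" using t by (simp add: power2_eq_1_iff)
  then show "P n = Q n" using eq by simp
qed

end


section \<open>Jacobi polynomials\<close>

text \<open>A measure on the whole line that charges only the interval: measurability remains Borel
  measurability, and restriction to the interval becomes an almost-everywhere statement.\<close>

definition jacobi_measure :: "real \<Rightarrow> real \<Rightarrow> real measure"
  where "jacobi_measure \<alpha> \<beta> = density lborel (\<lambda>x. indicator {-1..1} x * jacobi_weight \<alpha> \<beta> x)"

lemma jacobi_weight_nonneg: "0 \<le> jacobi_weight \<alpha> \<beta> x"
  by (simp add: jacobi_weight_def)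

lemma jacobi_weight_measurable [measurable]: "jacobi_weight \<alpha> \<beta> \<in> borel_measurable borel"
  unfolding jacobi_weight_def[abs_def] by measurable

lemma sets_jacobi_measure [simp, measurable_cong]: "sets (jacobi_measure \<alpha> \<beta>) = sets borel"
  by (simp add: jacobi_measure_def)

lemma space_jacobi_measure [simp]: "space (jacobi_measure \<alpha> \<beta>) = UNIV"
  by (simp add: jacobi_measure_def)

lemma measurable_jacobi_measure [simp]: "borel_measurable (jacobi_measure \<alpha> \<beta>) = borel_measurable borel"
  by (rule measurable_cong_sets) auto

lemma integral_jacobi_measure:
  assumes [measurable]: "f \<in> borel_measurable borel"
  shows "(\<integral>x. f x \<partial>jacobi_measure \<alpha> \<beta>) = (LINT x:{-1..1}|lborel. f x * jacobi_weight \<alpha> \<beta> x)"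
  unfolding jacobi_measure_def set_lebesgue_integral_def
  by (subst integral_real_density) (auto simp: jacobi_weight_nonneg mult_ac)

lemma integrable_jacobi_measure:
  assumes [measurable]: "f \<in> borel_measurable borel"
  shows "integrable (jacobi_measure \<alpha> \<beta>) f
    \<longleftrightarrow> set_integrable lborel {-1..1} (\<lambda>x. f x * jacobi_weight \<alpha> \<beta> x)"
  unfolding jacobi_measure_def set_integrable_def
  by (subst integrable_real_density) (auto simp: jacobi_weight_nonneg mult_ac)

lemma AE_jacobi_measure: "AE x in jacobi_measure \<alpha> \<beta>. x \<in> {-1..1}"
  unfolding jacobi_measure_def by (subst AE_density) (auto simp: indicator_def)

locale jacobi_parameters =
  fixes \<alpha> \<beta> :: real
  assumes \<alpha>: "\<alpha> > -1" and \<beta>: "\<beta> > -1"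
begin

abbreviation "\<mu> \<equiv> jacobi_measure \<alpha> \<beta>"

text \<open>The substitution \<open>t = (1 + x) / 2\<close> turns the weight, up to the factor
  \<open>2 powr \<alpha> * 2 powr \<beta>\<close>, into the integrand of the Beta function with
  parameters \<open>\<beta> + 1\<close> and \<open>\<alpha> + 1\<close>, which are positive.\<close>

lemma set_integrable_jacobi_weight: "set_integrable lborel {-1..1} (jacobi_weight \<alpha> \<beta>)"
proof -
  have "integrable lborel (\<lambda>t. indicator {0..1} t *\<^sub>R (t powr \<beta> * (1 - t) powr \<alpha>))"
    using integrable_Beta[of "\<beta> + 1" "\<alpha> + 1"] \<alpha> \<beta> by (simp add: set_integrable_def)
  then have "integrable lborel (\<lambda>x. indicator {0..1} (1/2 + 1/2 * x) *\<^sub>R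
      ((1/2 + 1/2 * x) powr \<beta> * (1 - (1/2 + 1/2 * x)) powr \<alpha>))"
    by (rule lborel_integrable_real_affine) simp
  then have "integrable lborel (\<lambda>x. 2 powr \<alpha> * 2 powr \<beta> * (indicator {0..1} (1/2 + 1/2 * x) *\<^sub>R
      ((1/2 + 1/2 * x) powr \<beta> * (1 - (1/2 + 1/2 * x)) powr \<alpha>)))"
    by (rule Bochner_Integration.integrable_mult_right)
  moreover have "2 powr \<alpha> * 2 powr \<beta> * (indicator {0..1} (1/2 + 1/2 * x) *\<^sub>R
      ((1/2 + 1/2 * x) powr \<beta> * (1 - (1/2 + 1/2 * x)) powr \<alpha>))
      = indicator {-1..1} x *\<^sub>R jacobi_weight \<alpha> \<beta> x" for x :: real
  proof (cases "x \<in> {-1..1}")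
    case True
    have "2 powr \<beta> * (1/2 + 1/2 * x) powr \<beta> = (2 * (1/2 + 1/2 * x)) powr \<beta>"
      by (rule powr_mult[symmetric])
    moreover have "2 powr \<alpha> * (1 - (1/2 + 1/2 * x)) powr \<alpha> = (2 * (1 - (1/2 + 1/2 * x))) powr \<alpha>"
      by (rule powr_mult[symmetric])
    moreover have "2 * (1/2 + 1/2 * x) = 1 + x" "2 * (1 - (1/2 + 1/2 * x)) = 1 - x"
      by simp_all
    ultimately have "(2 powr \<alpha> * (1 - (1/2 + 1/2 * x)) powr \<alpha>) * (2 powr \<beta> * (1/2 + 1/2 * x) powr \<beta>)
        = jacobi_weight \<alpha> \<beta> x"
      by (simp only: jacobi_weight_def)
    then show ?thesis
      using True by (auto simp: indicator_def mult_ac)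
  qed (auto simp: indicator_def)
  ultimately show ?thesis
    by (simp only: set_integrable_def)
qed

lemma finite_measure_jacobi: "finite_measure \<mu>"
proof -
  have "integrable \<mu> (\<lambda>x. 1 :: real)"
    using set_integrable_jacobi_weight by (subst integrable_jacobi_measure) auto
  then have "emeasure \<mu> (space \<mu>) < \<infinity>"
    by (simp add: integrable_iff_bounded)
  then show ?thesis
    by (intro finite_measureI) auto
qed

end

sublocale jacobi_parameters \<subseteq> finite_measure "jacobi_measure \<alpha> \<beta>"
  by (rule finite_measure_jacobi)

context jacobi_parameters
begin

lemma integrable_jacobi_continuous:
  assumes "continuous_on UNIV f"
  shows "integrable \<mu> (f :: real \<Rightarrow> real)"
proof -
  have [measurable]: "f \<in> borel_measurable borel"
    using assms by (rule borel_measurable_continuous_onI)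
  obtain c where c: "\<And>x. x \<in> {-1..1} \<Longrightarrow> norm (f x) \<le> c"
    using compact_imp_bounded[OF compact_continuous_image[OF continuous_on_subset[OF assms] compact_Icc], of "-1" 1]
    by (force simp: bounded_iff)
  show ?thesis
  proof (rule integrable_const_bound[where B = c])
    show "AE x in \<mu>. norm (f x) \<le> c"
      using AE_jacobi_measure by eventually_elim (rule c)
  qed simp
qed

lemma sq_integrable_jacobi_poly: "sq_integrable \<mu> (poly p)"
  unfolding sq_integrable_def
  by (auto intro!: integrable_jacobi_continuous continuous_intros borel_measurable_continuous_onI)

definition inner_poly :: "real poly \<Rightarrow> real poly \<Rightarrow> real"
  where "inner_poly p q = (\<integral>x. poly p x * poly q x \<partial>\<mu>)"

text \<open>A vanishing integral would force \<open>p\<close> to be 0 almost everywhere on the open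
  interval, where the weight is positive. But the roots of \<open>p\<close> form a finite, hence
  null set, and the interval is not null.\<close>

lemma inner_poly_pos:
  assumes "p \<noteq> 0"
  shows "inner_poly p p > 0"
proof -
  have "inner_poly p p \<noteq> 0"
  proof
    assume "inner_poly p p = 0"
    then have "AE x in \<mu>. poly p x * poly p x = 0"
      unfolding inner_poly_def
      by (subst (asm) integral_nonneg_eq_0_iff_AE)
         (auto intro!: integrable_jacobi_continuous continuous_intros)
    then have "AE x in lborel. 0 < indicator {-1..1} x * jacobi_weight \<alpha> \<beta> x \<longrightarrow> poly p x = 0"
      unfolding jacobi_measure_def by (subst (asm) AE_density) auto
    moreover have "AE x in lborel. x \<notin> {x. poly p x = 0}"
      using poly_roots_finite[OF assms] by (intro AE_not_in null_setsI)
        (auto intro: emeasure_lborel_countable countable_finite borel_closed finite_imp_closed)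
    ultimately have "AE x in lborel. x \<notin> {-1<..<1::real}"
      by eventually_elim (auto simp: jacobi_weight_def indicator_def)
    moreover have "{x \<in> space lborel. \<not> x \<notin> {-1<..<1::real}} = {-1<..<1}"
      by auto
    ultimately have "emeasure lborel {-1<..<1::real} = 0"
      using AE_iff_measurable[of "{-1<..<1::real}" lborel] by simp
    then show False by simp
  qed
  moreover have "inner_poly p p \<ge> 0"
    unfolding inner_poly_def by (intro Bochner_Integration.integral_nonneg) auto
  ultimately show ?thesis by simp
qed

end

sublocale jacobi_parameters \<subseteq> poly_inner_product inner_poly
proof
  fix p p' q c
  show "inner_poly (p + p') q = inner_poly p q + inner_poly p' q"
    unfolding inner_poly_def
    by (simp add: distrib_right sq_integrable_mult sq_integrable_jacobi_poly)
  show "inner_poly (smult c p) q = c * inner_poly p q"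
    by (simp add: inner_poly_def mult.assoc)
  show "inner_poly p q = inner_poly q p"
    by (simp add: inner_poly_def mult.commute)
  show "p \<noteq> 0 \<Longrightarrow> inner_poly p p > 0"
    by (rule inner_poly_pos)
qed

context jacobi_parameters
begin

text \<open>Existence and uniqueness from the abstract Gram-Schmidt theory give meaning to the
  definite description in \<open>jacobi\<close>.\<close>

lemma orthonormal_polys_jacobi: "orthonormal_polys (jacobi \<alpha> \<beta>)"
proof -
  have eq: "orthonormal_jacobi \<alpha> \<beta> P \<longleftrightarrow> orthonormal_polys P" for P
    unfolding orthonormal_jacobi_def orthonormal_polys_def inner_poly_def
    by (subst integral_jacobi_measure) (auto intro!: borel_measurable_continuous_onI continuous_intros)
  have "\<exists>!P. orthonormal_polys P"
    using orthonormal_polys_exist orthonormal_polys_unique by blast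
  then show ?thesis
    unfolding jacobi_def eq by (rule theI')
qed

lemma L2_subspace_poly: "L2_subspace \<mu> (range poly)"
proof
  show "subspace (range (poly :: real poly \<Rightarrow> _))"
    unfolding subspace_def
  proof (intro conjI allI impI ballI)
    show "0 \<in> range (poly :: real poly \<Rightarrow> _)"
      by (rule image_eqI[of _ _ 0]) (auto simp: zero_fun_def)
    show "f + g \<in> range poly" if "f \<in> range poly" "g \<in> range poly" for f g :: "real \<Rightarrow> real"
    proof -
      from that obtain p q where "f = poly p" "g = poly q" by auto
      then show ?thesis by (intro image_eqI[of _ _ "p + q"]) auto
    qed
    show "c *\<^sub>R f \<in> range poly" if "f \<in> range poly" for c and f :: "real \<Rightarrow> real"
    proof -
      from that obtain p where "f = poly p" by auto
      then show ?thesis by (intro image_eqI[of _ _ "smult c p"]) (auto simp: scaleR_fun_def)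
    qed
  qed
  show "\<And>g. g \<in> range poly \<Longrightarrow> sq_integrable \<mu> g"
    using sq_integrable_jacobi_poly by auto
qed

lemma L2_approx_continuous:
  assumes f: "continuous_on UNIV f"
  shows "L2_approx \<mu> (range poly) f"
  unfolding L2_approx_def
proof (intro conjI allI impI)
  show sq: "sq_integrable \<mu> f"
    using f by (auto simp: sq_integrable_def intro!: integrable_jacobi_continuous continuous_intros
        borel_measurable_continuous_onI)
  fix \<epsilon> :: real assume "\<epsilon> > 0"
  define m where "m = measure \<mu> (space \<mu>)"
  have "m \<ge> 0" by (simp add: m_def)
  \<comment> \<open>A uniform error \<delta> costs at most
    \<open>\<delta>\<^sup>2 * m = \<epsilon> * (m / (m + 1))\<close>; the added 1 avoids division by
    0 and makes the final inequality strict.\<close>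
  define \<delta> where "\<delta> = sqrt (\<epsilon> / (m + 1))"
  have "\<delta> > 0" using \<open>\<epsilon> > 0\<close> \<open>m \<ge> 0\<close> by (simp add: \<delta>_def)
  then obtain g where g: "polynomial_function g" "\<And>x. x \<in> {-1..1} \<Longrightarrow> norm (f x - g x) < \<delta>"
    using Stone_Weierstrass_polynomial_function[OF compact_Icc continuous_on_subset[OF f subset_UNIV]]
    by meson
  then obtain a n where a: "g = (\<lambda>x. \<Sum>i\<le>n. a i * x ^ i)"
    using real_polynomial_function_iff_sum[of g] by (auto simp: real_polynomial_function_eq)
  define p where "p = (\<Sum>i\<le>n. monom (a i) i)"
  have p: "poly p = g"
    by (auto simp: p_def a poly_sum poly_monom)
  have "(\<integral>x. (f x - poly p x)\<^sup>2 \<partial>\<mu>) \<le> (\<integral>x. \<delta>\<^sup>2 \<partial>\<mu>)"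
  proof (rule integral_mono_AE)
    show "integrable \<mu> (\<lambda>x. (f x - poly p x)\<^sup>2)"
      using sq_integrable_diff[OF sq sq_integrable_jacobi_poly] by (simp add: sq_integrable_def)
    show "AE x in \<mu>. (f x - poly p x)\<^sup>2 \<le> \<delta>\<^sup>2"
      using AE_jacobi_measure
    proof eventually_elim
      case (elim x)
      then have "\<bar>f x - poly p x\<bar> \<le> \<bar>\<delta>\<bar>"
        using g(2)[OF elim] p by simp
      then show ?case by (simp only: abs_le_square_iff)
    qed
  qed simp
  also have "\<dots> = \<epsilon> * (m / (m + 1))"
    using \<open>\<epsilon> > 0\<close> \<open>m \<ge> 0\<close> by (simp add: \<delta>_def m_def)
  also have "\<dots> < \<epsilon> * 1"
    using \<open>\<epsilon> > 0\<close> \<open>m \<ge> 0\<close> by (intro mult_strict_left_mono) auto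
  finally show "\<exists>h\<in>range poly. (\<integral>x. (f x - h x)\<^sup>2 \<partial>\<mu>) < \<epsilon>" by auto
qed

text \<open>Half-lines are closed under intersection and generate the Borel sets, and the indicator
  of a half-line is a bounded pointwise limit of continuous functions.\<close>

lemma L2_approx_indicator_poly:
  assumes "A \<in> sets borel"
  shows "L2_approx \<mu> (range poly) (indicator A)"
proof -
  interpret L2_subspace \<mu> "range poly" by (rule L2_subspace_poly)
  show ?thesis
  proof (rule L2_approx_indicator[where G = "range (\<lambda>a. {..a::real})"])
    show "Int_stable (range (\<lambda>a. {..a::real}))"
      by (auto simp: Int_stable_def)
    show "sets \<mu> = sigma_sets (space \<mu>) (range (\<lambda>a. {..a::real}))"
      unfolding sets_jacobi_measure borel_eq_atMost by (simp add: sets_measure_of)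
    have "L2_approx \<mu> (range poly) (\<lambda>x. 1)"
      by (rule L2_approx_continuous) (intro continuous_intros)
    then show "L2_approx \<mu> (range poly) (indicator (space \<mu>))"
      by (simp add: indicator_def[abs_def])
  next
    fix A assume "A \<in> range (\<lambda>a. {..a::real})"
    then obtain a where A: "A = {..a}" by auto
    \<comment> \<open>A ramp: 1 up to \<open>a\<close>, then falling with slope \<open>- n\<close>
      to the value 0. At a point right of \<open>a\<close> it vanishes as soon as \<open>n\<close>
      exceeds \<open>1 / (x - a)\<close>.\<close>
    define u where "u n x = max 0 (min 1 (1 - real n * (x - a)))" for n x
    show "L2_approx \<mu> (range poly) (indicator A)"
    proof (rule L2_approx_dominated[where g = "\<lambda>x. 1" and u = u])
      show "L2_approx \<mu> (range poly) (u n)" for n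
        unfolding u_def by (intro L2_approx_continuous continuous_intros)
      show "sq_integrable \<mu> (\<lambda>x. 1)" by (simp add: sq_integrable_def)
      show "\<bar>u n x\<bar> \<le> \<bar>1\<bar>" for n x by (simp add: u_def)
      show "(\<lambda>n. u n x) \<longlonglongrightarrow> indicator A x" for x
      proof (cases "x \<le> a")
        case True
        then have "u n x = 1" for n
          by (auto simp: u_def mult_nonneg_nonpos)
        then show ?thesis using True A by simp
      next
        case False
        then obtain m where m: "real m > 1 / (x - a)"
          using reals_Archimedean2 by blast
        have "u n x = 0" if "n \<ge> m" for n
        proof -
          have "1 < real m * (x - a)" using m False by (simp add: field_simps)
          also have "\<dots> \<le> real n * (x - a)" using that False by (intro mult_right_mono) auto
          finally show ?thesis by (simp add: u_def)
        qed
        then have "eventually (\<lambda>n. u n x = 0) sequentially"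
          by (auto simp: eventually_sequentially)
        then show ?thesis using False A by (simp add: tendsto_eventually)
      qed
    qed (auto simp: A)
  qed (use assms in auto)
qed

end


section \<open>The tensor product basis on the cube\<close>

context jacobi_parameters
begin

definition cube_measure :: "nat \<Rightarrow> (nat \<Rightarrow> real) measure"
  where "cube_measure s = density (cube s) (weight \<alpha> \<beta> s)"

lemma space_cube: "space (cube s) = {..<s} \<rightarrow>\<^sub>E {-1..1}"
  by (simp add: cube_def space_PiM space_restrict_space)

lemma space_cube_measure [simp]: "space (cube_measure s) = {..<s} \<rightarrow>\<^sub>E {-1..1}"
  by (simp add: cube_measure_def space_cube)

lemma sets_cube_measure [simp, measurable_cong]: "sets (cube_measure s) = sets (cube s)"
  by (simp add: cube_measure_def)

lemma measurable_cube_measure [simp]: "borel_measurable (cube_measure s) = borel_measurable (cube s)"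
  by (rule measurable_cong_sets) auto

lemma measurable_coordinate [measurable (raw)]:
  assumes "f \<in> borel_measurable borel" "j \<in> {..<s}"
  shows "(\<lambda>x. f (x j)) \<in> borel_measurable (cube s)"
proof -
  have "(\<lambda>x. x j) \<in> measurable (cube s) (restrict_space lborel {-1..1})"
    unfolding cube_def using assms(2) by (rule measurable_component_singleton)
  moreover have "f \<in> borel_measurable (restrict_space lborel {-1..1})"
    using assms(1) by (intro measurable_restrict_space1) simp
  ultimately show ?thesis
    by (rule measurable_compose)
qed

lemma weight_measurable [measurable]: "weight \<alpha> \<beta> s \<in> borel_measurable (cube s)"
  unfolding weight_def[abs_def] by (intro borel_measurable_prod measurable_coordinate) auto

lemma weight_nonneg: "0 \<le> weight \<alpha> \<beta> s x"
  by (auto simp: weight_def intro!: prod_nonneg jacobi_weight_nonneg)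

lemma integral_cube_measure:
  "f \<in> borel_measurable (cube s) \<Longrightarrow>
    (\<integral>x. f x \<partial>cube_measure s) = (\<integral>x. f x * weight \<alpha> \<beta> s x \<partial>cube s)"
  unfolding cube_measure_def
  by (subst integral_real_density) (auto simp: weight_nonneg mult_ac)

lemma integrable_cube_measure:
  "f \<in> borel_measurable (cube s) \<Longrightarrow>
    integrable (cube_measure s) f \<longleftrightarrow> integrable (cube s) (\<lambda>x. f x * weight \<alpha> \<beta> s x)"
  unfolding cube_measure_def
  by (subst integrable_real_density) (auto simp: weight_nonneg mult_ac)

text \<open>Fubini for products of one-variable functions. The cube carries a density over a product
  of restricted Lebesgue measures; the weight is split among the coordinates so that each factor
  becomes an integral over \<open>\<mu>\<close>.\<close>

lemma
  fixes f :: "nat \<Rightarrow> real \<Rightarrow> real"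
  assumes f: "\<And>j. j < s \<Longrightarrow> integrable \<mu> (f j)"
  shows integrable_cube_prod: "integrable (cube_measure s) (\<lambda>x. \<Prod>j<s. f j (x j))"
    and integral_cube_prod: "(\<integral>x. (\<Prod>j<s. f j (x j)) \<partial>cube_measure s) = (\<Prod>j<s. \<integral>x. f j x \<partial>\<mu>)"
proof -
  interpret product_sigma_finite "\<lambda>_ :: nat. restrict_space lborel {-1..1::real}"
    unfolding product_sigma_finite_def
    by (auto intro: sigma_finite_measure_restrict_space sigma_finite_lborel)
  have meas: "f j \<in> borel_measurable borel" if "j < s" for j
    using borel_measurable_integrable[OF f[OF that]] by simp
  have prod_meas: "(\<lambda>x. \<Prod>j<s. f j (x j)) \<in> borel_measurable (cube s)"
    using meas by (intro borel_measurable_prod measurable_coordinate) auto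
  have int: "integrable (restrict_space lborel {-1..1}) (\<lambda>x. f j x * jacobi_weight \<alpha> \<beta> x)" if "j \<in> {..<s}" for j
    using f[of j] that integrable_jacobi_measure[OF meas, of j]
    by (subst integrable_restrict_space) (auto simp: set_integrable_def)
  have eq: "(\<Prod>j<s. f j (x j)) * weight \<alpha> \<beta> s x = (\<Prod>j<s. f j (x j) * jacobi_weight \<alpha> \<beta> (x j))" for x
    by (simp add: weight_def prod.distrib)
  show "integrable (cube_measure s) (\<lambda>x. \<Prod>j<s. f j (x j))"
    unfolding integrable_cube_measure[OF prod_meas] eq cube_def
    using product_integrable_prod[OF finite_lessThan int] .
  have "(\<integral>x. (\<Prod>j<s. f j (x j)) \<partial>cube_measure s)
      = (\<Prod>j<s. \<integral>x. f j x * jacobi_weight \<alpha> \<beta> x \<partial>restrict_space lborel {-1..1})"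
    unfolding integral_cube_measure[OF prod_meas] eq cube_def
    using product_integral_prod[OF finite_lessThan int] .
  also have "\<dots> = (\<Prod>j<s. \<integral>x. f j x \<partial>\<mu>)"
  proof (rule prod.cong)
    fix j assume "j \<in> {..<s}"
    then show "(\<integral>x. f j x * jacobi_weight \<alpha> \<beta> x \<partial>restrict_space lborel {-1..1}) = (\<integral>x. f j x \<partial>\<mu>)"
      using integral_jacobi_measure[OF meas, of j]
      by (subst integral_restrict_space) (auto simp: set_lebesgue_integral_def)
  qed simp
  finally show "(\<integral>x. (\<Prod>j<s. f j (x j)) \<partial>cube_measure s) = (\<Prod>j<s. \<integral>x. f j x \<partial>\<mu>)" .
qed

lemma finite_cube_measure: "finite_measure (cube_measure s)"
proof -
  have "integrable (cube_measure s) (\<lambda>x. \<Prod>j<s. (1 :: real))"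
    by (rule integrable_cube_prod) simp
  then have "emeasure (cube_measure s) (space (cube_measure s)) < \<infinity>"
    by (simp add: integrable_iff_bounded)
  then show ?thesis
    by (intro finite_measureI) auto
qed

lemma sq_integrable_cube_prod:
  assumes "\<And>j. j < s \<Longrightarrow> sq_integrable \<mu> (f j)"
  shows "sq_integrable (cube_measure s) (\<lambda>x. \<Prod>j<s. f j (x j))"
  unfolding sq_integrable_def
proof
  show "(\<lambda>x. \<Prod>j<s. f j (x j)) \<in> borel_measurable (cube_measure s)"
    unfolding measurable_cube_measure using assms
    by (intro borel_measurable_prod measurable_coordinate) (auto simp: sq_integrable_def)
  show "integrable (cube_measure s) (\<lambda>x. (\<Prod>j<s. f j (x j))\<^sup>2)"
    unfolding prod_power_distrib using assms
    by (intro integrable_cube_prod[where f = "\<lambda>j x. (f j x)\<^sup>2"]) (auto simp: sq_integrable_def)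
qed

lemma jacobi_multi_L2_orthonormal:
  "L2_orthonormal (cube_measure s) (multi_indices s) (jacobi_multi \<alpha> \<beta> s)"
proof
  show "sq_integrable (cube_measure s) (jacobi_multi \<alpha> \<beta> s k)" for k
    unfolding jacobi_multi_def[abs_def] by (intro sq_integrable_cube_prod sq_integrable_jacobi_poly)
  fix j k assume jk: "j \<in> multi_indices s" "k \<in> multi_indices s"
  have "(\<integral>x. jacobi_multi \<alpha> \<beta> s j x * jacobi_multi \<alpha> \<beta> s k x \<partial>cube_measure s)
      = (\<integral>x. (\<Prod>i<s. poly (jacobi \<alpha> \<beta> (j i)) (x i) * poly (jacobi \<alpha> \<beta> (k i)) (x i)) \<partial>cube_measure s)"
    by (simp add: jacobi_multi_def prod.distrib)
  also have "\<dots> = (\<Prod>i<s. inner_poly (jacobi \<alpha> \<beta> (j i)) (jacobi \<alpha> \<beta> (k i)))"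
    unfolding inner_poly_def
    by (intro integral_cube_prod[where f = "\<lambda>i x. poly (jacobi \<alpha> \<beta> (j i)) x * poly (jacobi \<alpha> \<beta> (k i)) x"]
        sq_integrable_mult sq_integrable_jacobi_poly)
  also have "\<dots> = (\<Prod>i<s. if j i = k i then 1 else 0)"
    using orthonormal_polys_jacobi by (simp add: orthonormal_polys_def)
  also have "\<dots> = (if j = k then 1 else 0)"
  proof (cases "j = k")
    case False
    \<comment> \<open>Multi-indices are extensional, so distinct ones differ at a coordinate below
      \<open>s\<close>, where the product has a factor 0.\<close>
    then obtain i where "i < s" "j i \<noteq> k i"
      using jk by (metis PiE_ext lessThan_iff multi_indices_def)
    then show ?thesis using False by (auto intro!: prod_zero)
  qed simp
  finally show "(\<integral>x. jacobi_multi \<alpha> \<beta> s j x * jacobi_multi \<alpha> \<beta> s k x \<partial>cube_measure s)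
      = (if j = k then 1 else 0)" .
qed

abbreviation "multi_span s \<equiv> span (jacobi_multi \<alpha> \<beta> s ` multi_indices s)"

lemma prod_poly_in_span: "(\<lambda>x. \<Prod>j<s. poly (p j) (x j)) \<in> multi_span s"
proof -
  \<comment> \<open>A common degree bound for all factors; each is expanded in the first
    \<open>n\<close> Jacobi polynomials and the product is multiplied out.\<close>
  define n where "n = Suc (\<Sum>j<s. degree (p j))"
  have "p j \<in> polys_below n" if "j < s" for j
  proof -
    have "degree (p j) \<le> (\<Sum>j<s. degree (p j))"
      using that by (intro member_le_sum) auto
    then show ?thesis
      by (auto simp: polys_below_def n_def intro!: coeff_eq_0)
  qed
  then have "\<forall>j. \<exists>c. j < s \<longrightarrow> p j = (\<Sum>i<n. smult (c i) (jacobi \<alpha> \<beta> i))"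
    using orthonormal_polys_span[OF orthonormal_polys_jacobi] by blast
  then obtain c where c: "\<And>j. j < s \<Longrightarrow> p j = (\<Sum>i<n. smult (c j i) (jacobi \<alpha> \<beta> i))"
    by metis
  let ?K = "{..<s} \<rightarrow>\<^sub>E {..<n}"
  have "(\<lambda>x. \<Prod>j<s. poly (p j) (x j)) = (\<Sum>k\<in>?K. (\<Prod>j<s. c j (k j)) *\<^sub>R jacobi_multi \<alpha> \<beta> s k)"
  proof
    fix x :: "nat \<Rightarrow> real"
    have "(\<Prod>j<s. poly (p j) (x j)) = (\<Prod>j<s. \<Sum>i<n. c j i * poly (jacobi \<alpha> \<beta> i) (x j))"
      by (intro prod.cong) (auto simp: c poly_sum)
    also have "\<dots> = (\<Sum>k\<in>?K. \<Prod>j<s. c j (k j) * poly (jacobi \<alpha> \<beta> (k j)) (x j))"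
      by (rule prod_sum_PiE) auto
    also have "\<dots> = (\<Sum>k\<in>?K. ((\<Prod>j<s. c j (k j)) *\<^sub>R jacobi_multi \<alpha> \<beta> s k) x)"
      by (simp add: prod.distrib scaleR_fun_def jacobi_multi_def)
    also have "\<dots> = (\<Sum>k\<in>?K. (\<Prod>j<s. c j (k j)) *\<^sub>R jacobi_multi \<alpha> \<beta> s k) x"
    proof -
      have "(\<Sum>k\<in>A. F k x) = (\<Sum>k\<in>A. F k) x" for A :: "(nat \<Rightarrow> nat) set" and F :: "_ \<Rightarrow> (nat \<Rightarrow> real) \<Rightarrow> real"
        by (induction A rule: infinite_finite_induct) auto
      then show ?thesis .
    qed
    finally show "(\<Prod>j<s. poly (p j) (x j)) = \<dots>" .
  qed
  also have "\<dots> \<in> multi_span s"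
    by (intro span_sum span_scale span_base imageI) (auto simp: multi_indices_def PiE_def)
  finally show ?thesis .
qed

lemma L2_subspace_multi_span: "L2_subspace (cube_measure s) (multi_span s)"
proof -
  interpret L2_orthonormal "cube_measure s" "multi_indices s" "jacobi_multi \<alpha> \<beta> s"
    by (rule jacobi_multi_L2_orthonormal)
  interpret finite_measure "cube_measure s"
    by (rule finite_cube_measure)
  have "multi_span s \<subseteq> {f. sq_integrable (cube_measure s) f}"
    using sq_e by (intro span_minimal subspace_sq_integrable) auto
  then show ?thesis
    by unfold_locales auto
qed

text \<open>
  The factors are replaced by polynomials one coordinate at a time: the error of one replacement
  is a product, so its norm factorises.
\<close>

lemma L2_approx_cube_prod:
  assumes "m \<le> s" "\<And>j. j < m \<Longrightarrow> L2_approx \<mu> (range poly) (f j)"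
    and "\<And>j. m \<le> j \<Longrightarrow> j < s \<Longrightarrow> f j \<in> range poly"
  shows "L2_approx (cube_measure s) (multi_span s) (\<lambda>x. \<Prod>j<s. f j (x j))"
  using assms
proof (induction m arbitrary: f)
  case 0
  then have "\<forall>j. \<exists>p. j < s \<longrightarrow> f j = poly p" by blast
  then obtain p where p: "\<And>j. j < s \<Longrightarrow> f j = poly (p j)" by metis
  have V: "(\<lambda>x. \<Prod>j<s. f j (x j)) \<in> multi_span s"
    using prod_poly_in_span[of p s] by (simp add: p)
  interpret L2_subspace "cube_measure s" "multi_span s" by (rule L2_subspace_multi_span)
  show ?case
    unfolding L2_approx_def using sq_V[OF V] V by (auto intro!: bexI[OF _ V])
next
  case (Suc m)
  interpret L2_subspace "cube_measure s" "multi_span s" by (rule L2_subspace_multi_span)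
  have ms: "m < s" using Suc.prems(1) by simp
  have sq: "sq_integrable \<mu> (f j)" if js: "j < s" for j
  proof (cases "j < Suc m")
    case True
    then show ?thesis using Suc.prems(2) L2_approx_sq by blast
  next
    case False
    then obtain p where "f j = poly p" using Suc.prems(3)[of j] js False by auto
    then show ?thesis using sq_integrable_jacobi_poly by simp
  qed
  have "\<exists>p. (\<integral>x. (f m x - poly p x)\<^sup>2 \<partial>\<mu>) < inverse (real (Suc n))" for n
    using L2_approxD[OF Suc.prems(2)[of m], of "inverse (real (Suc n))"] by auto
  then obtain p where p: "\<And>n. (\<integral>x. (f m x - poly (p n) x)\<^sup>2 \<partial>\<mu>) < inverse (real (Suc n))"
    by metis
  show ?case
  proof (rule L2_approx_limit[where u = "\<lambda>n x. \<Prod>j<s. (f(m := poly (p n))) j (x j)"])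
    show "sq_integrable (cube_measure s) (\<lambda>x. \<Prod>j<s. f j (x j))"
      by (intro sq_integrable_cube_prod sq)
    \<comment> \<open>With coordinate \<open>m\<close> now a polynomial, only the first
      \<open>m\<close> factors may be non-polynomial, so the induction hypothesis applies.\<close>
    show "L2_approx (cube_measure s) (multi_span s) (\<lambda>x. \<Prod>j<s. (f(m := poly (p n))) j (x j))" for n
      by (rule Suc.IH) (use Suc.prems in auto)
    \<comment> \<open>The contribution of the unchanged coordinates, independent of
      \<open>n\<close>; convergence in coordinate \<open>m\<close> alone therefore suffices.\<close>
    define C where "C = (\<Prod>j\<in>{..<s} - {m}. \<integral>x. (f j x)\<^sup>2 \<partial>\<mu>)"
    have "C \<ge> 0" unfolding C_def by (intro prod_nonneg) auto
    have eq: "(\<integral>x. ((\<Prod>j<s. f j (x j)) - (\<Prod>j<s. (f(m := poly (p n))) j (x j)))\<^sup>2 \<partial>cube_measure s)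
        = (\<integral>x. (f m x - poly (p n) x)\<^sup>2 \<partial>\<mu>) * C" for n
    proof -
      define h where "h = f(m := \<lambda>x. f m x - poly (p n) x)"
      have h: "sq_integrable \<mu> (h j)" if "j < s" for j
        using sq that sq_integrable_diff[OF sq sq_integrable_jacobi_poly] by (auto simp: h_def)
      have "(\<Prod>j<s. f j (x j)) - (\<Prod>j<s. (f(m := poly (p n))) j (x j)) = (\<Prod>j<s. h j (x j))" for x
        using ms by (simp add: prod.remove[of "{..<s}" m] h_def left_diff_distrib)
      then have "(\<integral>x. ((\<Prod>j<s. f j (x j)) - (\<Prod>j<s. (f(m := poly (p n))) j (x j)))\<^sup>2 \<partial>cube_measure s)
          = (\<integral>x. (\<Prod>j<s. (h j (x j))\<^sup>2) \<partial>cube_measure s)"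
        by (simp add: prod_power_distrib)
      also have "\<dots> = (\<Prod>j<s. \<integral>x. (h j x)\<^sup>2 \<partial>\<mu>)"
        using h by (intro integral_cube_prod[where f = "\<lambda>j x. (h j x)\<^sup>2"] sq_integrable_square) auto
      also have "\<dots> = (\<integral>x. (f m x - poly (p n) x)\<^sup>2 \<partial>\<mu>) * C"
        using ms by (simp add: prod.remove[of "{..<s}" m] h_def C_def)
      finally show ?thesis .
    qed
    have "(\<lambda>n. \<integral>x. (f m x - poly (p n) x)\<^sup>2 \<partial>\<mu>) \<longlonglongrightarrow> 0"
      using p by (intro tendsto_sandwich[OF _ _ tendsto_const LIMSEQ_inverse_real_of_nat])
        (auto intro!: always_eventually less_imp_le)
    then show "(\<lambda>n. \<integral>x. ((\<Prod>j<s. f j (x j)) - (\<Prod>j<s. (f(m := poly (p n))) j (x j)))\<^sup>2 \<partial>cube_measure s)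
        \<longlonglongrightarrow> 0"
      unfolding eq by (auto intro: tendsto_mult_left_zero)
  qed
qed

text \<open>Measurable boxes form an intersection-stable generator, and the indicator of a box is a
  product of one-variable indicators, each in the closure of the polynomials.\<close>

lemma jacobi_multi_L2_basis:
  "L2_basis (cube_measure s) (multi_indices s) (jacobi_multi \<alpha> \<beta> s)"
proof -
  interpret L2_orthonormal "cube_measure s" "multi_indices s" "jacobi_multi \<alpha> \<beta> s"
    by (rule jacobi_multi_L2_orthonormal)
  interpret L2_subspace "cube_measure s" "multi_span s" by (rule L2_subspace_multi_span)
  let ?N = "\<lambda>_ :: nat. restrict_space lborel {-1..1::real}"
  have box: "L2_approx (cube_measure s) (multi_span s) (indicator (PiE {..<s} E))"
    if E: "\<And>j. j < s \<Longrightarrow> E j \<in> sets (restrict_space lborel {-1..1})" for E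
  proof -
    have "L2_approx (cube_measure s) (multi_span s) (\<lambda>x. \<Prod>j<s. indicator (E j) (x j))"
      using E by (intro L2_approx_cube_prod[of s] L2_approx_indicator_poly)
        (auto simp: sets_restrict_space_iff)
    moreover have "(\<Prod>j<s. indicator (E j) (x j)) = (indicator (PiE {..<s} E) x :: real)"
      if "x \<in> space (cube_measure s)" for x
      using that by (auto simp: indicator_def PiE_iff intro!: prod.neutral)
    ultimately show ?thesis
      by (subst L2_approx_cong[symmetric])
  qed
  have "L2_approx (cube_measure s) (multi_span s) f" if f: "sq_integrable (cube_measure s) f" for f
  proof (rule L2_approx_all[OF _ f])
    fix A assume A: "A \<in> sets (cube_measure s)"
    show "L2_approx (cube_measure s) (multi_span s) (indicator A)"
    proof (rule L2_approx_indicator[OF _ _ _ _ _ A])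
      show "Int_stable (prod_algebra {..<s} ?N)"
        by (rule Int_stable_prod_algebra)
      show "prod_algebra {..<s} ?N \<subseteq> Pow (space (cube_measure s))"
        using prod_algebra_sets_into_space[of "{..<s}" ?N]
        by (simp add: space_restrict_space)
      show "sets (cube_measure s) = sigma_sets (space (cube_measure s)) (prod_algebra {..<s} ?N)"
        by (simp add: cube_def sets_PiM space_restrict_space)
      show "L2_approx (cube_measure s) (multi_span s) (indicator (space (cube_measure s)))"
        unfolding space_cube_measure by (rule box) (simp add: sets_restrict_space_iff)
      fix B assume "B \<in> prod_algebra {..<s} ?N"
      then obtain E where "B = PiE {..<s} E" "E \<in> (\<Pi> j\<in>{..<s}. sets (restrict_space lborel {-1..1}))"
        by (rule prod_algebraE_all)
      then show "L2_approx (cube_measure s) (multi_span s) (indicator B)"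
        using box[of E] by auto
    qed
  qed
  then show ?thesis by unfold_locales
qed

section \<open>The weighted spaces as plain square-integrable functions for
  \<open>cube_measure\<close>\<close>

lemma L2_space_eq: "L2_space \<alpha> \<beta> s = {f. sq_integrable (cube_measure s) f}"
  by (auto simp: L2_space_def sq_integrable_def integrable_cube_measure)

lemma L2_norm_eq:
  "sq_integrable (cube_measure s) f \<Longrightarrow> L2_norm \<alpha> \<beta> s f = sqrt (\<integral>x. (f x)\<^sup>2 \<partial>cube_measure s)"
  by (auto simp: L2_norm_def L2_inner_def sq_integrable_def integral_cube_measure power2_eq_square)

lemma jacobi_coeff_eq:
  assumes "sq_integrable (cube_measure s) f"
  shows "jacobi_coeff \<alpha> \<beta> s f k = L2_orthonormal.fcoeff (cube_measure s) (jacobi_multi \<alpha> \<beta> s) f k"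
proof -
  interpret L2_orthonormal "cube_measure s" "multi_indices s" "jacobi_multi \<alpha> \<beta> s"
    by (rule jacobi_multi_L2_orthonormal)
  have "jacobi_multi \<alpha> \<beta> s k \<in> borel_measurable (cube s)"
    unfolding jacobi_multi_def[abs_def]
    by (intro borel_measurable_prod measurable_coordinate) (auto intro!: borel_measurable_continuous_onI continuous_intros)
  then show ?thesis
    using assms by (auto simp: fcoeff_def jacobi_coeff_def L2_inner_def integral_cube_measure sq_integrable_def)
qed

end


section \<open>Counting multi-indices\<close>

text \<open>The normalised form of \<open>lam\<close>: \<open>lam a s k = a ^ s * rho a s k\<close>.
  The radius of the ball cancels the power of \<open>a\<close>, which leaves factors that are all at
  least 1.\<close>

definition rho :: "real \<Rightarrow> nat \<Rightarrow> (nat \<Rightarrow> nat) \<Rightarrow> real"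
  where "rho a s k = (\<Prod>j<s. 1 + real (k j) / a)"

lemma rho_ge_1: "a > 0 \<Longrightarrow> 1 \<le> rho a s k"
  unfolding rho_def by (intro prod_ge_1) auto

lemma lam_powr:
  assumes "a > 0"
  shows "lam a s k powr (2 * r) = (a powr (r * real s))\<^sup>2 * (rho a s k powr r)\<^sup>2"
proof -
  have "lam a s k = (\<Prod>j<s. a * (1 + real (k j) / a))"
    unfolding lam_def using assms by (intro prod.cong) (auto simp: field_simps)
  also have "\<dots> = a ^ s * rho a s k"
    by (simp add: prod.distrib rho_def)
  finally have "lam a s k = a powr real s * rho a s k"
    using assms by (simp add: powr_realpow)
  then have "lam a s k powr (2 * r) = (a powr real s) powr (2 * r) * rho a s k powr (2 * r)"
    by (simp only: powr_mult)
  also have "\<dots> = (a powr (r * real s) * a powr (r * real s)) * (rho a s k powr r * rho a s k powr r)"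
    unfolding powr_add[symmetric] powr_powr by (simp add: algebra_simps)
  finally show ?thesis by (simp only: power2_eq_square)
qed

definition large_indices :: "real \<Rightarrow> real \<Rightarrow> real \<Rightarrow> nat \<Rightarrow> (nat \<Rightarrow> nat) set"
  where "large_indices a r \<epsilon> s = {k \<in> multi_indices s. rho a s k powr r < 1 / \<epsilon>}"

text \<open>Since every factor of \<open>rho\<close> is at least 1, each single factor is bounded by
  the whole product, and this bounds every entry of the index.\<close>

lemma large_indices_bounded:
  assumes "a > 0" "r > 0" "0 < \<epsilon>"
  obtains n where "large_indices a r \<epsilon> s \<subseteq> {..<s} \<rightarrow>\<^sub>E {..<n}"
proof -
  define T where "T = (1 / \<epsilon>) powr (1 / r)"
  have "k j < nat \<lceil>a * T\<rceil>" if k: "k \<in> large_indices a r \<epsilon> s" and j: "j < s" for k j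
  proof -
    have "rho a s k = (rho a s k powr r) powr (1 / r)"
      using rho_ge_1[OF assms(1), of s k] assms by (simp add: powr_powr)
    also have "\<dots> < T"
      unfolding T_def using k assms by (intro powr_less_mono2) (auto simp: large_indices_def)
    finally have "rho a s k < T" .
    moreover have "1 + real (k j) / a \<le> rho a s k"
    proof -
      have "rho a s k = (1 + real (k j) / a) * (\<Prod>i\<in>{..<s} - {j}. 1 + real (k i) / a)"
        unfolding rho_def using j by (intro prod.remove) auto
      moreover have "1 \<le> (\<Prod>i\<in>{..<s} - {j}. 1 + real (k i) / a)"
        using assms by (intro prod_ge_1) auto
      moreover have "0 \<le> 1 + real (k j) / a" using assms by simp
      ultimately show ?thesis
        using mult_left_mono[of 1 _ "1 + real (k j) / a"] by simp
    qed
    ultimately have "real (k j) / a < T" by linarith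
    then have "real (k j) < a * T" using assms by (simp add: field_simps)
    then show ?thesis by linarith
  qed
  then have "large_indices a r \<epsilon> s \<subseteq> {..<s} \<rightarrow>\<^sub>E {..<nat \<lceil>a * T\<rceil>}"
    by (intro subsetI) (simp add: PiE_iff, simp add: large_indices_def multi_indices_def PiE_iff)
  then show ?thesis by (rule that)
qed

lemma finite_large_indices:
  assumes "a > 0" "r > 0" "0 < \<epsilon>"
  shows "finite (large_indices a r \<epsilon> s)"
proof -
  obtain n where "large_indices a r \<epsilon> s \<subseteq> {..<s} \<rightarrow>\<^sub>E {..<n}"
    using large_indices_bounded[OF assms] .
  then show ?thesis by (rule finite_subset) (auto intro: finite_PiE)
qed

text \<open>Rankin's method: each index is counted with the weight \<open>(\<epsilon> \<rho>\<^sup>r)\<^sup>-\<^sup>t \<ge> 1\<close>.\<close>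

lemma card_large_indices_le:
  assumes a: "a > 0" "r > 0" "0 < \<epsilon>" and "t \<ge> 0"
    and Z: "\<And>n. (\<Sum>i<n. (1 + real i / a) powr (- (r * t))) \<le> Z"
  shows "real (card (large_indices a r \<epsilon> s)) \<le> \<epsilon> powr (- t) * Z ^ s"
proof -
  let ?A = "large_indices a r \<epsilon> s"
  obtain n where n: "?A \<subseteq> {..<s} \<rightarrow>\<^sub>E {..<n}"
    using large_indices_bounded[OF a] .
  have "real (card ?A) = (\<Sum>k\<in>?A. 1)" by simp
  also have "\<dots> \<le> (\<Sum>k\<in>?A. \<epsilon> powr (- t) * rho a s k powr (- (r * t)))"
  proof (rule sum_mono)
    fix k assume "k \<in> ?A"
    then have "\<epsilon> * rho a s k powr r \<le> 1"
      using a by (simp add: large_indices_def field_simps)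
    moreover have "0 < \<epsilon> * rho a s k powr r"
      using a rho_ge_1[OF a(1), of s k] by simp
    ultimately have "1 \<le> (\<epsilon> * rho a s k powr r) powr (- t)"
      using \<open>t \<ge> 0\<close> powr_mono2'[of "- t" "\<epsilon> * rho a s k powr r" 1] by simp
    then show "1 \<le> \<epsilon> powr (- t) * rho a s k powr (- (r * t))"
      by (simp add: powr_mult powr_powr)
  qed
  \<comment> \<open>Passing to a full box adds only nonnegative terms and makes the sum factorise
    over the coordinates.\<close>
  also have "\<dots> \<le> (\<Sum>k\<in>{..<s} \<rightarrow>\<^sub>E {..<n}. \<epsilon> powr (- t) * rho a s k powr (- (r * t)))"
    using n by (intro sum_mono2) (auto intro: finite_PiE)
  also have "\<dots> = \<epsilon> powr (- t) * (\<Sum>k\<in>{..<s} \<rightarrow>\<^sub>E {..<n}. \<Prod>j<s. (1 + real (k j) / a) powr (- (r * t)))"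
    using a by (simp add: sum_distrib_left rho_def prod_powr_distrib)
  also have "\<dots> = \<epsilon> powr (- t) * (\<Prod>j<s. \<Sum>i<n. (1 + real i / a) powr (- (r * t)))"
    by (subst prod_sum_PiE) auto
  also have "\<dots> = \<epsilon> powr (- t) * (\<Sum>i<n. (1 + real i / a) powr (- (r * t))) ^ s"
    by simp
  also have "\<dots> \<le> \<epsilon> powr (- t) * Z ^ s"
    using Z[of n] by (intro mult_left_mono power_mono) (auto intro: sum_nonneg)
  finally show ?thesis .
qed

text \<open>The term \<open>i = 0\<close> is always 1. For the others the exponent
  \<open>m + 2\<close> is split: two powers give convergence by comparison with inverse squares, and
  \<open>m\<close> powers give a factor at most \<open>(1 / (1 + 1 / a)) ^ m\<close>, as small as
  desired.\<close>

lemma sum_powr_close_to_1: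
  fixes a r \<eta> :: real
  assumes "a > 0" "r > 0" "\<eta> > 0"
  obtains t where "t \<ge> 0" "\<And>n. (\<Sum>i<n. (1 + real i / a) powr (- (r * t))) \<le> 1 + \<eta>"
proof -
  define S where "S = (\<Sum>i. inverse (real (Suc i) ^ 2))"
  have summ: "summable (\<lambda>i. inverse (real (Suc i) ^ 2))"
    using inverse_power_summable[of 2, where 'a = real] by (subst summable_Suc_iff) simp
  have "S \<ge> 0" unfolding S_def by (rule suminf_nonneg[OF summ]) simp
  \<comment> \<open>The remaining terms sum to at most \<open>\<eta>' * a\<^sup>2 * S\<close>, which
    this choice keeps below \<eta>; the added 1 ensures a positive denominator.\<close>
  define \<eta>' where "\<eta>' = \<eta> / (a\<^sup>2 * S + 1)"
  have "a\<^sup>2 * S + 1 > 0" using \<open>S \<ge> 0\<close> by (simp add: add_nonneg_pos)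
  then have "\<eta>' > 0" using assms by (simp add: \<eta>'_def)
  have "1 / (1 + 1 / a) < 1" using assms by (simp add: field_simps)
  then obtain m where m: "(1 / (1 + 1 / a)) ^ m < \<eta>'"
    using real_arch_pow_inv[OF \<open>\<eta>' > 0\<close>] by blast
  define t where "t = (real m + 2) / r"
  have rt: "r * t = real (m + 2)" using assms by (simp add: t_def)
  have le: "(1 + real (Suc i) / a) powr (- (r * t)) \<le> \<eta>' * a\<^sup>2 * inverse (real (Suc i) ^ 2)" for i
  proof -
    define y where "y = 1 + real (Suc i) / a"
    have y: "y > 0" "1 + 1 / a \<le> y" "real (Suc i) / a \<le> y"
      using assms by (auto simp: y_def divide_right_mono add_pos_nonneg)
    have "y powr (- (r * t)) = inverse (y ^ m) * inverse (y ^ 2)"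
      unfolding rt powr_minus using y(1) by (subst powr_realpow) (auto simp: power_add power2_eq_square)
    also have "\<dots> \<le> \<eta>' * inverse ((real (Suc i) / a) ^ 2)"
    proof (rule mult_mono)
      have "inverse (y ^ m) \<le> inverse ((1 + 1 / a) ^ m)"
        using y assms by (intro le_imp_inverse_le power_mono zero_less_power) (auto simp: add_pos_pos)
      then show "inverse (y ^ m) \<le> \<eta>'"
        using m by (simp add: power_one_over inverse_eq_divide)
      show "inverse (y ^ 2) \<le> inverse ((real (Suc i) / a) ^ 2)"
        using y assms by (intro le_imp_inverse_le power_mono zero_less_power) auto
    qed (use \<open>\<eta>' > 0\<close> y in auto)
    also have "\<dots> = \<eta>' * a\<^sup>2 * inverse (real (Suc i) ^ 2)"
      by (simp add: power_divide inverse_eq_divide)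
    finally show ?thesis by (simp add: y_def)
  qed
  have "(\<Sum>i<n. (1 + real i / a) powr (- (r * t))) \<le> 1 + \<eta>" for n
  proof (cases n)
    case (Suc n')
    have "(\<Sum>i<n. (1 + real i / a) powr (- (r * t))) = 1 + (\<Sum>i<n'. (1 + real (Suc i) / a) powr (- (r * t)))"
      unfolding Suc by (subst sum.lessThan_Suc_shift) simp
    also have "(\<Sum>i<n'. (1 + real (Suc i) / a) powr (- (r * t)))
        \<le> (\<Sum>i<n'. \<eta>' * a\<^sup>2 * inverse (real (Suc i) ^ 2))"
      by (intro sum_mono le)
    also have "\<dots> = \<eta>' * a\<^sup>2 * (\<Sum>i<n'. inverse (real (Suc i) ^ 2))"
      by (simp add: sum_distrib_left)
    also have "\<dots> \<le> \<eta>' * a\<^sup>2 * S"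
      unfolding S_def using \<open>\<eta>' > 0\<close> by (intro mult_left_mono sum_le_suminf summ) auto
    also have "\<dots> \<le> \<eta>' * (a\<^sup>2 * S + 1)"
      using \<open>\<eta>' > 0\<close> by (simp add: algebra_simps)
    also have "\<dots> = \<eta>"
      using \<open>a\<^sup>2 * S + 1 > 0\<close> by (simp add: \<eta>'_def)
    finally show ?thesis by simp
  qed (use assms in auto)
  moreover have "t \<ge> 0" using assms by (simp add: t_def)
  ultimately show ?thesis using that by blast
qed

section \<open>Zero-one indices for the lower bound\<close>

definition sparse_indices :: "nat \<Rightarrow> nat \<Rightarrow> (nat \<Rightarrow> nat) set"
  where "sparse_indices m s = (\<lambda>S. \<lambda>j\<in>{..<s}. if j \<in> S then 1 else 0) ` {S. S \<subseteq> {..<s} \<and> card S = m}"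

lemma sparse_indices_subset: "sparse_indices m s \<subseteq> multi_indices s"
  unfolding sparse_indices_def multi_indices_def by (intro image_subsetI restrict_PiE_iff[THEN iffD2]) simp

lemma finite_sparse_indices: "finite (sparse_indices m s)"
  unfolding sparse_indices_def by (rule finite_imageI, rule finite_subset[of _ "Pow {..<s}"]) auto

lemma card_sparse_indices: "card (sparse_indices m s) = s choose m"
proof -
  have "inj_on (\<lambda>S. \<lambda>j\<in>{..<s}. if j \<in> S then 1 else 0 :: nat) {S. S \<subseteq> {..<s} \<and> card S = m}"
  proof (rule inj_onI)
    fix S T assume S: "S \<in> {S. S \<subseteq> {..<s} \<and> card S = m}" and T: "T \<in> {S. S \<subseteq> {..<s} \<and> card S = m}"
      and eq: "(\<lambda>j\<in>{..<s}. if j \<in> S then 1 else 0 :: nat) = (\<lambda>j\<in>{..<s}. if j \<in> T then 1 else 0)"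
    have "j \<in> S \<longleftrightarrow> j \<in> T" if "j < s" for j
      using fun_cong[OF eq, of j] that by (auto split: if_splits)
    then show "S = T" using S T by auto
  qed
  then show ?thesis
    by (simp add: sparse_indices_def card_image n_subsets)
qed

lemma rho_sparse_indices:
  assumes "k \<in> sparse_indices m s"
  shows "rho a s k = (1 + 1 / a) ^ m"
proof -
  obtain S where S: "S \<subseteq> {..<s}" "card S = m" and k: "k = (\<lambda>j\<in>{..<s}. if j \<in> S then 1 else 0)"
    using assms by (auto simp: sparse_indices_def)
  have "rho a s k = (\<Prod>j<s. if j \<in> S then 1 + 1 / a else 1)"
    unfolding rho_def by (intro prod.cong) (auto simp: k)
  also have "\<dots> = (\<Prod>j\<in>S. 1 + 1 / a)"
    using S(1) by (subst prod.If_cases) (auto simp: Int_absorb1)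
  finally show ?thesis using S(2) by simp
qed


section \<open>The \<open>\<epsilon>\<close>-dimension of the ball\<close>

lemma ln_dim_mono: "m \<le> n \<Longrightarrow> ln_dim m \<le> ln_dim n"
  by (cases m; cases n) (auto simp: ln_dim_def)

lemma ln_dim_nonneg: "0 \<le> ln_dim n"
  by (cases n) (auto simp: ln_dim_def)

text \<open>The assumption \<open>1 \<le> b\<close> covers the dimension 0, whose logarithm is 0 by
  convention.\<close>

lemma ln_dim_le:
  assumes "n \<le> enat N" "real N \<le> b" "1 \<le> b"
  shows "ln_dim n \<le> ereal (ln b)"
proof -
  have "ln_dim n \<le> ln_dim (enat N)" using assms(1) by (rule ln_dim_mono)
  also have "\<dots> \<le> ereal (ln b)" using assms(2,3) by (auto simp: ln_dim_def)
  finally show ?thesis .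
qed

context jacobi_parameters
begin

text \<open>The ellipsoid inequality in the normalised weights, on finite index sets: this is the
  form in which \<open>eps_dim_le\<close> asks for control of the tail.\<close>

lemma scaled_ball_coeffs:
  assumes a: "a > 0" and f: "f \<in> (*\<^sub>R) (a powr (r * real s)) ` U_ball \<alpha> \<beta> r a s"
  shows "sq_integrable (cube_measure s) f"
    and "finite B \<Longrightarrow> B \<subseteq> multi_indices s \<Longrightarrow> (\<Sum>k\<in>B. (rho a s k powr r)\<^sup>2 *
      (L2_orthonormal.fcoeff (cube_measure s) (jacobi_multi \<alpha> \<beta> s) f k)\<^sup>2) \<le> 1"
proof -
  interpret L2_orthonormal "cube_measure s" "multi_indices s" "jacobi_multi \<alpha> \<beta> s"
    by (rule jacobi_multi_L2_orthonormal)
  define c where "c = a powr (r * real s)"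
  obtain u where u: "u \<in> U_ball \<alpha> \<beta> r a s" and fu: "f = c *\<^sub>R u"
    using f by (auto simp: c_def)
  have sq: "sq_integrable (cube_measure s) u"
    using u by (auto simp: U_ball_def K_space_def L2_space_eq)
  then show "sq_integrable (cube_measure s) f"
    unfolding fu scaleR_fun_def by (auto intro: sq_integrable_cmult)
  have fc: "fcoeff f k = c * fcoeff u k" for k
    by (simp add: fcoeff_def fu scaleR_fun_def mult.assoc)
  let ?g = "\<lambda>k. lam a s k powr (2 * r) * \<bar>jacobi_coeff \<alpha> \<beta> s u k\<bar>\<^sup>2"
  assume B: "finite B" "B \<subseteq> multi_indices s"
  have eq: "(rho a s k powr r)\<^sup>2 * (fcoeff f k)\<^sup>2 = ?g k" for k
    by (simp add: lam_powr[OF a] fc jacobi_coeff_eq[OF sq] c_def power_mult_distrib)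
  have "(\<Sum>k\<in>B. (rho a s k powr r)\<^sup>2 * (fcoeff f k)\<^sup>2) \<le> (\<Sum>\<^sub>\<infinity>k\<in>multi_indices s. ?g k)"
    unfolding eq using u B by (intro finite_sum_le_infsum) (auto simp: U_ball_def K_space_def)
  also have "\<dots> \<le> 1"
    using u by (auto simp: U_ball_def K_norm_def)
  finally show "(\<Sum>k\<in>B. (rho a s k powr r)\<^sup>2 * (fcoeff f k)\<^sup>2) \<le> 1" .
qed

text \<open>The converse for finite expansions: coefficients outside \<open>A\<close> vanish, so the
  infinite sum in the norm collapses to a finite one.\<close>

lemma sum_in_scaled_ball:
  assumes a: "a > 0" and A: "finite A" "A \<subseteq> multi_indices s"
    and d: "(\<Sum>k\<in>A. (rho a s k powr r)\<^sup>2 * (d k)\<^sup>2) \<le> 1"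
  shows "(\<lambda>x. \<Sum>k\<in>A. d k * jacobi_multi \<alpha> \<beta> s k x) \<in> (*\<^sub>R) (a powr (r * real s)) ` U_ball \<alpha> \<beta> r a s"
proof -
  interpret L2_orthonormal "cube_measure s" "multi_indices s" "jacobi_multi \<alpha> \<beta> s"
    by (rule jacobi_multi_L2_orthonormal)
  define c where "c = a powr (r * real s)"
  have c: "c > 0" using a by (simp add: c_def)
  define u where "u = (\<lambda>x. \<Sum>k\<in>A. (d k / c) * jacobi_multi \<alpha> \<beta> s k x)"
  have sq: "sq_integrable (cube_measure s) u"
    unfolding u_def by (rule sq_sum[OF A(2)])
  let ?g = "\<lambda>k. lam a s k powr (2 * r) * \<bar>jacobi_coeff \<alpha> \<beta> s u k\<bar>\<^sup>2"
  have eq: "?g k = (if k \<in> A then (rho a s k powr r)\<^sup>2 * (d k)\<^sup>2 else 0)" if "k \<in> multi_indices s" for k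
  proof -
    have "jacobi_coeff \<alpha> \<beta> s u k = (if k \<in> A then d k / c else 0)"
      unfolding jacobi_coeff_eq[OF sq] unfolding u_def by (rule fcoeff_sum[OF A that])
    then show ?thesis
      using c by (auto simp: lam_powr[OF a] power_divide simp flip: c_def)
  qed
  have "(?g has_sum (\<Sum>k\<in>A. (rho a s k powr r)\<^sup>2 * (d k)\<^sup>2)) A"
    using A eq by (intro has_sum_finiteI sum.cong) auto
  then have sum: "(?g has_sum (\<Sum>k\<in>A. (rho a s k powr r)\<^sup>2 * (d k)\<^sup>2)) (multi_indices s)"
    by (rule has_sum_cong_neutral[THEN iffD1, rotated -1]) (use A eq in auto)
  then have "u \<in> K_space \<alpha> \<beta> r a s"
    using sq by (auto simp: K_space_def L2_space_eq summable_on_def)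
  moreover have "K_norm \<alpha> \<beta> r a s u \<le> 1"
    using d infsumI[OF sum] by (simp add: K_norm_def)
  moreover have "(\<lambda>x. \<Sum>k\<in>A. d k * jacobi_multi \<alpha> \<beta> s k x) = c *\<^sub>R u"
    using c by (auto simp: u_def scaleR_fun_def sum_distrib_left)
  ultimately show ?thesis
    by (auto simp: U_ball_def c_def)
qed

lemma n_eps_le:
  assumes "a > 0" "r > 0" "0 < \<epsilon>"
  shows "n_eps \<alpha> \<beta> r a \<epsilon> s \<le> enat (card (large_indices a r \<epsilon> s))"
proof -
  interpret L2_basis "cube_measure s" "multi_indices s" "jacobi_multi \<alpha> \<beta> s"
    by (rule jacobi_multi_L2_basis)
  let ?A = "large_indices a r \<epsilon> s"
  show ?thesis
    unfolding n_eps_def L2_space_eq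
  proof (rule eps_dim_le[OF L2_norm_eq])
    show "finite ?A" "?A \<subseteq> multi_indices s"
      using finite_large_indices[OF assms] by (auto simp: large_indices_def)
    fix f assume f: "f \<in> (*\<^sub>R) (a powr (r * real s)) ` U_ball \<alpha> \<beta> r a s"
    show "sq_integrable (cube_measure s) f"
      by (rule scaled_ball_coeffs[OF assms(1) f])
    fix B assume B: "finite B" "B \<subseteq> multi_indices s - ?A"
    \<comment> \<open>Outside the counted indices \<open>\<epsilon> * rho a s k powr r\<close> is at
      least 1, so inserting its square can only increase the sum and produces the ellipsoid
      inequality.\<close>
    have "(\<Sum>k\<in>B. (fcoeff f k)\<^sup>2) \<le> (\<Sum>k\<in>B. \<epsilon>\<^sup>2 * ((rho a s k powr r)\<^sup>2 * (fcoeff f k)\<^sup>2))"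
    proof (rule sum_mono)
      fix k assume "k \<in> B"
      then have "1 / \<epsilon> \<le> rho a s k powr r"
        using B(2) by (auto simp: large_indices_def not_less)
      then have "1 \<le> \<epsilon> * rho a s k powr r"
        using assms(3) by (simp add: pos_divide_le_eq mult.commute)
      then have "1 \<le> (\<epsilon> * rho a s k powr r)\<^sup>2" by simp
      then have "1 * (fcoeff f k)\<^sup>2 \<le> (\<epsilon> * rho a s k powr r)\<^sup>2 * (fcoeff f k)\<^sup>2"
        by (intro mult_right_mono) auto
      then show "(fcoeff f k)\<^sup>2 \<le> \<epsilon>\<^sup>2 * ((rho a s k powr r)\<^sup>2 * (fcoeff f k)\<^sup>2)"
        by (simp add: power_mult_distrib mult.assoc)
    qed
    also have "\<dots> = \<epsilon>\<^sup>2 * (\<Sum>k\<in>B. (rho a s k powr r)\<^sup>2 * (fcoeff f k)\<^sup>2)"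
      by (simp add: sum_distrib_left)
    also have "\<dots> \<le> \<epsilon>\<^sup>2 * 1"
      using B by (intro mult_left_mono scaled_ball_coeffs(2)[OF assms(1) f]) auto
    finally show "(\<Sum>k\<in>B. (fcoeff f k)\<^sup>2) \<le> \<epsilon>\<^sup>2" by simp
  qed (use assms in auto)
qed

text \<open>On the sparse indices \<open>rho\<close> is constant, so this section of the ellipsoid
  is a ball; its radius is \<open>1 / b\<close>, which exceeds \<epsilon>.\<close>

lemma n_eps_ge:
  assumes "a > 0" "0 \<le> \<epsilon>" and \<epsilon>: "\<epsilon> * ((1 + 1 / a) ^ m) powr r < 1"
  shows "enat (s choose m) \<le> n_eps \<alpha> \<beta> r a \<epsilon> s"
proof -
  interpret L2_orthonormal "cube_measure s" "multi_indices s" "jacobi_multi \<alpha> \<beta> s"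
    by (rule jacobi_multi_L2_orthonormal)
  define b where "b = ((1 + 1 / a) ^ m) powr r"
  have "1 + 1 / a > 0" using assms(1) by (simp add: add_pos_pos)
  then have b: "b > 0" by (simp add: b_def)
  have "enat (card (sparse_indices m s)) \<le> n_eps \<alpha> \<beta> r a \<epsilon> s"
    unfolding n_eps_def L2_space_eq
  proof (rule eps_dim_ge[OF L2_norm_eq, where \<delta> = "1 / b"])
    show "\<epsilon> < 1 / b" using \<epsilon> b by (simp add: field_simps flip: b_def)
    fix d :: "(nat \<Rightarrow> nat) \<Rightarrow> real"
    assume d: "(\<Sum>k\<in>sparse_indices m s. (d k)\<^sup>2) = (1 / b)\<^sup>2"
    have "(\<Sum>k\<in>sparse_indices m s. (rho a s k powr r)\<^sup>2 * (d k)\<^sup>2) = b\<^sup>2 * (\<Sum>k\<in>sparse_indices m s. (d k)\<^sup>2)"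
      unfolding sum_distrib_left by (intro sum.cong) (auto simp: rho_sparse_indices b_def)
    then have "(\<Sum>k\<in>sparse_indices m s. (rho a s k powr r)\<^sup>2 * (d k)\<^sup>2) \<le> 1"
      unfolding d using b by (simp add: power_divide)
    then show "(\<lambda>x. \<Sum>k\<in>sparse_indices m s. d k * jacobi_multi \<alpha> \<beta> s k x)
        \<in> (*\<^sub>R) (a powr (r * real s)) ` U_ball \<alpha> \<beta> r a s"
      by (intro sum_in_scaled_ball assms finite_sparse_indices sparse_indices_subset)
  qed (use assms finite_sparse_indices sparse_indices_subset in auto)
  then show ?thesis by (simp add: card_sparse_indices)
qed

lemma polynomially_intractable_n_eps:
  assumes "a > 0"
  shows "polynomially_intractable (n_eps \<alpha> \<beta> r a)"
  unfolding polynomially_intractable_def polynomially_tractable_def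
proof (clarify)
  fix C p q :: real
  assume C: "0 \<le> C" and "0 \<le> p" and q: "0 \<le> q"
    and bound: "\<forall>\<epsilon>\<in>{0<..1}. \<forall>s\<ge>1. ereal_of_enat (n_eps \<alpha> \<beta> r a \<epsilon> s) \<le> ereal (C * real s powr q * \<epsilon> powr (- p))"
  \<comment> \<open>At least \<open>q + 1\<close>, so that \<open>s ^ m\<close> beats
    \<open>s powr q\<close> by a full factor \<open>s\<close>.\<close>
  define m where "m = nat \<lceil>q\<rceil> + 1"
  have m: "q + 1 \<le> real m" using q unfolding m_def by linarith
  define b where "b = ((1 + 1 / a) ^ m) powr r"
  have "1 + 1 / a > 0" using assms by (simp add: add_pos_pos)
  then have b: "b > 0" by (simp add: b_def)
  \<comment> \<open>Any admissible value with \<open>\<epsilon> * b < 1\<close> would do; it matters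
    that it does not depend on \<open>s\<close>.\<close>
  define \<epsilon> where "\<epsilon> = 1 / (b + 1)"
  have \<epsilon>: "0 < \<epsilon>" "\<epsilon> \<le> 1" "\<epsilon> * b < 1" using b by (auto simp: \<epsilon>_def)
  define D where "D = real m ^ m * (C * \<epsilon> powr (- p))"
  have "real s \<le> D" if s: "s \<ge> m" for s
  proof -
    have "m \<ge> 1" "s \<ge> 1" using s by (auto simp: m_def)
    have "ereal_of_enat (enat (s choose m)) \<le> ereal_of_enat (n_eps \<alpha> \<beta> r a \<epsilon> s)"
      using n_eps_ge[of a \<epsilon> m r s] assms \<epsilon> by (simp only: ereal_of_enat_le_iff) (simp add: b_def)
    also have "\<dots> \<le> ereal (C * real s powr q * \<epsilon> powr (- p))"
      using bound \<epsilon> \<open>s \<ge> 1\<close> by simp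
    finally have "real (s choose m) \<le> C * real s powr q * \<epsilon> powr (- p)"
      by simp
    moreover have "(real s / real m) ^ m \<le> real (s choose m)"
      using binomial_ge_n_over_k_pow_k[OF s, where 'a = real] by simp
    ultimately have "real s ^ m / real m ^ m \<le> real s powr q * (C * \<epsilon> powr (- p))"
      by (simp add: power_divide mult_ac)
    then have "real s ^ m \<le> real s powr q * D"
      using \<open>m \<ge> 1\<close> by (simp add: D_def divide_le_eq mult_ac)
    moreover have "real s powr q * real s \<le> real s ^ m"
    proof -
      have "real s powr q * real s = real s powr (q + 1)"
        using \<open>s \<ge> 1\<close> by (simp add: powr_add)
      also have "\<dots> \<le> real s powr real m"
        using \<open>s \<ge> 1\<close> m by (intro powr_mono) auto
      finally show ?thesis using \<open>s \<ge> 1\<close> by (simp add: powr_realpow)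
    qed
    ultimately have "real s powr q * real s \<le> real s powr q * D" by linarith
    then show ?thesis using \<open>s \<ge> 1\<close> by simp
  qed
  \<comment> \<open>This \<open>s\<close> is at least \<open>m\<close> and larger than
    \<open>D\<close>, contrary to the bound just shown.\<close>
  from this[of "max m (nat \<lceil>D\<rceil> + 1)"] show False by linarith
qed

lemma weakly_tractable_n_eps:
  assumes "a > 0" "r > 0"
  shows "weakly_tractable (n_eps \<alpha> \<beta> r a)"
  unfolding weakly_tractable_def
proof (rule order_tendstoI)
  let ?F = "inf (filtercomap (\<lambda>(\<epsilon>, s). 1 / \<epsilon> + real s) at_top) (principal ({0<..1::real} \<times> {1::nat..}))"
  \<comment> \<open>A threshold for the sum \<open>1 / \<epsilon> + s\<close>, uniform over all
    admissible pairs: either variable alone may drive the limit.\<close>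
  have ev: "eventually P ?F \<longleftrightarrow> (\<exists>X. \<forall>\<epsilon> s. 0 < \<epsilon> \<longrightarrow> \<epsilon> \<le> 1 \<longrightarrow> 1 \<le> s \<longrightarrow> X \<le> 1 / \<epsilon> + real s \<longrightarrow> P (\<epsilon>, s))" for P
    unfolding eventually_inf_principal eventually_filtercomap_at_top_linorder
    by (simp only: split_paired_All case_prod_conv mem_Times_iff fst_conv snd_conv
        greaterThanAtMost_iff atLeast_iff) blast
  fix z :: ereal
  {
    assume "z < 0"
    then show "\<forall>\<^sub>F x in ?F. z < (case x of (\<epsilon>, s) \<Rightarrow> ln_dim (n_eps \<alpha> \<beta> r a \<epsilon> s) / ereal (1 / \<epsilon> + real s))"
      unfolding ev case_prod_conv
    proof (intro exI allI impI)
      fix \<epsilon> :: real and s :: nat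
      assume "0 < \<epsilon>"
      then have "0 \<le> ln_dim (n_eps \<alpha> \<beta> r a \<epsilon> s) / ereal (1 / \<epsilon> + real s)"
        by (intro zero_le_divide_ereal ln_dim_nonneg) simp
      with \<open>z < 0\<close> show "z < ln_dim (n_eps \<alpha> \<beta> r a \<epsilon> s) / ereal (1 / \<epsilon> + real s)"
        by (rule less_le_trans)
    qed
  next
    assume "0 < z"
    then obtain \<eta> where \<eta>: "0 < \<eta>" "ereal \<eta> < z"
      using ereal_dense2[of 0 z] by auto
    \<comment> \<open>Half of \<eta> pays for the factor exponential in \<open>s\<close>, the other
      half for the power of \<open>1 / \<epsilon>\<close>. From here on \<open>t\<close> is
      fixed.\<close>
    obtain t where t: "t \<ge> 0" "\<And>n. (\<Sum>i<n. (1 + real i / a) powr (- (r * t))) \<le> 1 + \<eta> / 2"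
      using sum_powr_close_to_1[OF assms, of "\<eta> / 2"] \<eta> by auto
    have "((\<lambda>y::real. ln y / y) \<longlongrightarrow> 0) at_top" by (rule ln_x_over_x_tendsto_0)
    \<comment> \<open>The denominator has \<open>t + 1\<close> instead of \<open>t\<close> because
      \<open>t = 0\<close> is allowed.\<close>
    then have "\<forall>\<^sub>F y in at_top. ln y / y < \<eta> / (2 * (t + 1))"
      using \<eta> t by (intro order_tendstoD) auto
    then obtain X where X: "\<And>y. y \<ge> X \<Longrightarrow> ln y / y < \<eta> / (2 * (t + 1))"
      by (auto simp: eventually_at_top_linorder)
    have "ln_dim (n_eps \<alpha> \<beta> r a \<epsilon> s) / ereal (1 / \<epsilon> + real s) < z"
      if \<epsilon>: "0 < \<epsilon>" "\<epsilon> \<le> 1" and "1 \<le> s" "X \<le> 1 / \<epsilon> + real s" for \<epsilon> s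
    proof -
      define y where "y = 1 / \<epsilon> + real s"
      have y: "y > 0" "1 / \<epsilon> \<le> y" "real s \<le> y" "X \<le> y"
        using that by (auto simp: y_def add_pos_nonneg)
      define b where "b = \<epsilon> powr (- t) * (1 + \<eta> / 2) ^ s"
      have "1 \<le> \<epsilon> powr (- t)"
        using \<epsilon> t(1) powr_mono2'[of "- t" \<epsilon> 1] by simp
      moreover have "1 \<le> (1 + \<eta> / 2) ^ s"
        using \<eta> by (intro one_le_power) auto
      ultimately have "1 * 1 \<le> b"
        unfolding b_def by (intro mult_mono) auto
      then have "ln_dim (n_eps \<alpha> \<beta> r a \<epsilon> s) \<le> ereal (ln b)"
        using n_eps_le[OF assms \<epsilon>(1), of s] card_large_indices_le[OF assms \<epsilon>(1) t, of s]
        by (intro ln_dim_le) (auto simp: b_def)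
      moreover have "ln b < \<eta> * y"
      proof -
        have "ln b = t * ln (1 / \<epsilon>) + real s * ln (1 + \<eta> / 2)"
          using \<epsilon> \<eta> by (simp add: b_def ln_mult ln_powr ln_realpow ln_div)
        also have "\<dots> \<le> t * ln y + y * (\<eta> / 2)"
        proof (intro add_mono mult_left_mono mult_mono)
          show "ln (1 / \<epsilon>) \<le> ln y" using y \<epsilon> by simp
          show "ln (1 + \<eta> / 2) \<le> \<eta> / 2" using \<eta> by (intro ln_add_one_self_le_self) auto
        qed (use t y \<eta> in auto)
        \<comment> \<open>Legitimate since \<open>y \<ge> 1 / \<epsilon> \<ge> 1\<close> makes the
          logarithm nonnegative.\<close>
        also have "t * ln y \<le> (t + 1) * ln y"
        proof -
          have "1 \<le> 1 / \<epsilon>" using \<epsilon> by simp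
          then have "0 \<le> ln y" using y by simp
          then show ?thesis by (simp add: distrib_right)
        qed
        also have "\<dots> < \<eta> / 2 * y"
        proof -
          have "ln y < \<eta> / (2 * (t + 1)) * y"
            using X[OF y(4)] y(1) by (simp only: pos_divide_less_eq)
          then have "(t + 1) * ln y < (t + 1) * (\<eta> / (2 * (t + 1)) * y)"
            using t(1) by (intro mult_strict_left_mono) auto
          also have "\<dots> = \<eta> / 2 * y"
            using t(1) by (simp add: field_simps)
          finally show ?thesis .
        qed
        finally show ?thesis by simp
      qed
      ultimately have "ln_dim (n_eps \<alpha> \<beta> r a \<epsilon> s) \<le> ereal (\<eta> * y)"
        by (metis ereal_less_eq(3) less_imp_le order_trans)
      then have "ln_dim (n_eps \<alpha> \<beta> r a \<epsilon> s) / ereal y \<le> ereal \<eta>"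
        using y(1) by (subst ereal_divide_le_pos) (auto simp: mult.commute)
      then show ?thesis
        using \<eta>(2) by (simp add: y_def)
    qed
    then show "\<forall>\<^sub>F x in ?F. (case x of (\<epsilon>, s) \<Rightarrow> ln_dim (n_eps \<alpha> \<beta> r a \<epsilon> s) / ereal (1 / \<epsilon> + real s)) < z"
      unfolding ev case_prod_conv by blast
  }
qed

end

theorem theorem6p8:
  fixes \<alpha> \<beta> a r :: real
  assumes "\<alpha> > -1" and "\<beta> > -1"
    and "a = (\<alpha> + \<beta> + 1) / 2"
    and "a > 0"
    and "r > 0"
  shows "weakly_tractable (n_eps \<alpha> \<beta> r a) \<and> polynomially_intractable (n_eps \<alpha> \<beta> r a)"
proof -
  interpret jacobi_parameters \<alpha> \<beta>
    using assms(1,2) by unfold_locales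
  show ?thesis
    using weakly_tractable_n_eps polynomially_intractable_n_eps assms(4,5) by blast
qed

end
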